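(* Let $\mathrm{mCoarse}$ denote the category of metric spaces and coarse maps modulo closeness, $\mathrm{Top}$ the category of topological spaces and continuous maps, and $\mathrm{Unif}$ the category of uniform spaces and uniformly continuous maps. Then the space of ends, $X\mapsto \mathcal{E}(X)$ on objects and $[f]\mapsto \mathcal{E}(f)$ with $\mathcal{E}(f)([\varphi])=[f\circ\varphi]$ on morphisms, is a functor $\mathcal{E}:\mathrm{mCoarse}\to \mathrm{Top}$, and it is a functor $\mathcal{E}:\mathrm{mCoarse}\to \mathrm{Unif}$.
   Context: Metrics are finite-valued. Let $(X,d)$ be a metric space. A subset $E\subseteq X\times X$ is an entourage of $X$ if $\sup_{(x,y)\in E}d(x,y)<\infty$; $B\subseteq X$ is bounded if $B\times B$ is an entourage. A subset $C\subseteq X\times X$ is a coentourage if every sequence $(x_i,y_i)_i$ in $C$ is either bounded (both $(x_i)_i$ and $(y_i)_i$ are bounded) or the set of values $d(x_i,y_i)$ is unbounded; equivalently, for every entourage $E$ there is a bounded set $B$ with $E\cap C\subseteq B\times B$. For an entourage $E$ and $A\subseteq X$ put $E[A]=\{x\in X:\exists a\in A,\ (x,a)\in E\}$. Two subsets $A,B\subseteq X$ are close if $A\times B$ is not a coentourage. A map $f:X\to Y$ of metric spaces is coarse if $(f\times f)(E)$ is an entourage of $Y$ for every entourage $E$ of $X$, and $f^{-1}(B)$ is bounded for every bounded $B\subseteq Y$. Two maps $f,g:X\to Y$ are close if $\{(f(x),g(x)):x\in X\}$ is an entourage of $Y$. A coarse cover of $X$ is a finite family $\mathcal U=(U_i)_i$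 of subsets of $X$ such that $(X\times X)\setminus\bigcup_i (U_i\times U_i)$ is a coentourage. For $S\subseteq X$ the coarse star is $\mathrm{cst}(S,\mathcal U)=\bigcup\{U_i: S \text{ is close to } U_i\}$. Let $\mathbb Z_+$ be the non-negative integers with the standard metric. The set $\mathcal E(X)$ consists of endpoints: equivalence classes $[\phi]$ of coarse maps $\phi:\mathbb Z_+\to X$, where $\phi$ and $\psi$ are equivalent if $\phi(\mathbb Z_+)$ and $\psi(\mathbb Z_+)$ have finite Hausdorff distance. For a coarse cover $\mathcal U$ and endpoints $p=[\phi]$, $q=[\psi]$ write $q\in\mathcal U[p]$ if there is an entourage $E$ of $X$ with $\psi(\mathbb Z_+)\subseteq E[\mathrm{cst}(\phi(\mathbb Z_+),\mathcal U)]$ and $\phi(\mathbb Z_+)\subseteq E[\mathrm{cst}(\psi(\mathbb Z_+),\mathcal U)]$. The uniformity on $\mathcal E(X)$ has as base the sets $D_{\mathcal U}=\{(p,q): q\in\mathcal U[p]\}$, with $\mathcal U$ ranging over all coarse covers of $X$. The topology on $\mathcal E(X)$ is the induced one: $O\subseteq\mathcal E(X)$ is open iff for every $p\in O$ there is a coarse cover $\mathcal U$ with $\mathcal U[p]\subseteq O$. *)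

theory Defs
  imports "HOL-Analysis.Analysis"
begin

section \<open>Categories and functors\<close>

text \<open>Composition is written in the order of function composition:
  \<open>Comp C x y z g f\<close> is \<open>g \<circ> f\<close> for \<open>f : x \<rightarrow> y\<close> and \<open>g : y \<rightarrow> z\<close>.\<close>

record ('o, 'm) cat =
  Obj :: "'o set"
  Hom :: "'o \<Rightarrow> 'o \<Rightarrow> 'm set"
  Ident :: "'o \<Rightarrow> 'm"
  Comp :: "'o \<Rightarrow> 'o \<Rightarrow> 'o \<Rightarrow> 'm \<Rightarrow> 'm \<Rightarrow> 'm"

locale is_category =
  fixes C :: "('o, 'm) cat"
  assumes ident_in_hom: "x \<in> Obj C \<Longrightarrow> Ident C x \<in> Hom C x x"
    and comp_in_hom:
      "\<lbrakk>x \<in> Obj C; y \<in> Obj C; z \<in> Obj C; f \<in> Hom C x y; g \<in> Hom C y z\<rbrakk>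
        \<Longrightarrow> Comp C x y z g f \<in> Hom C x z"
    and comp_ident_left:
      "\<lbrakk>x \<in> Obj C; y \<in> Obj C; f \<in> Hom C x y\<rbrakk> \<Longrightarrow> Comp C x y y (Ident C y) f = f"
    and comp_ident_right:
      "\<lbrakk>x \<in> Obj C; y \<in> Obj C; f \<in> Hom C x y\<rbrakk> \<Longrightarrow> Comp C x x y f (Ident C x) = f"
    and comp_assoc:
      "\<lbrakk>w \<in> Obj C; x \<in> Obj C; y \<in> Obj C; z \<in> Obj C;
        f \<in> Hom C w x; g \<in> Hom C x y; h \<in> Hom C y z\<rbrakk>
        \<Longrightarrow> Comp C w y z h (Comp C w x y g f) = Comp C w x z (Comp C x y z h g) f"

locale is_functor = source: is_category C + target: is_category D
  for C :: "('o, 'm) cat" and D :: "('p, 'n) cat" +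
  fixes F_obj :: "'o \<Rightarrow> 'p"
    and F_map :: "'o \<Rightarrow> 'o \<Rightarrow> 'm \<Rightarrow> 'n"
  assumes obj: "x \<in> Obj C \<Longrightarrow> F_obj x \<in> Obj D"
    and hom:
      "\<lbrakk>x \<in> Obj C; y \<in> Obj C; f \<in> Hom C x y\<rbrakk>
        \<Longrightarrow> F_map x y f \<in> Hom D (F_obj x) (F_obj y)"
    and ident: "x \<in> Obj C \<Longrightarrow> F_map x x (Ident C x) = Ident D (F_obj x)"
    and comp:
      "\<lbrakk>x \<in> Obj C; y \<in> Obj C; z \<in> Obj C; f \<in> Hom C x y; g \<in> Hom C y z\<rbrakk>
        \<Longrightarrow> F_map x z (Comp C x y z g f)
            = Comp D (F_obj x) (F_obj y) (F_obj z) (F_map y z g) (F_map x y f)"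


section \<open>Topological and uniform spaces\<close>

text \<open>Arrows are extensional functions on the carrier, so that equality of arrows is
  equality of maps.\<close>

definition Top :: "('p topology, 'p \<Rightarrow> 'p) cat" where
  "Top = \<lparr> Obj = UNIV,
           Hom = (\<lambda>S T. {f \<in> topspace S \<rightarrow>\<^sub>E topspace T. continuous_map S T f}),
           Ident = (\<lambda>S. restrict id (topspace S)),
           Comp = (\<lambda>S T U g f. compose (topspace S) g f) \<rparr>"

definition uniform_structure :: "'p set \<Rightarrow> ('p \<times> 'p) set set \<Rightarrow> bool" where
  "uniform_structure A \<V> \<longleftrightarrow>
     \<V> \<noteq> {} \<and>
     (\<forall>V\<in>\<V>. Id_on A \<subseteq> V \<and> V \<subseteq> A \<times> A) \<and>
     (\<forall>V\<in>\<V>. \<forall>W. V \<subseteq> W \<and> W \<subseteq> A \<times> A \<longrightarrow> W \<in> \<V>) \<and>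
     (\<forall>V\<in>\<V>. \<forall>W\<in>\<V>. V \<inter> W \<in> \<V>) \<and>
     (\<forall>V\<in>\<V>. V\<inverse> \<in> \<V>) \<and>
     (\<forall>V\<in>\<V>. \<exists>W\<in>\<V>. W O W \<subseteq> V)"

definition uniform_map ::
  "'p set \<times> ('p \<times> 'p) set set \<Rightarrow> 'q set \<times> ('q \<times> 'q) set set \<Rightarrow> ('p \<Rightarrow> 'q) \<Rightarrow> bool" where
  "uniform_map S T f \<longleftrightarrow>
     f \<in> fst S \<rightarrow> fst T \<and>
     (\<forall>V\<in>snd T. {(p, q) \<in> fst S \<times> fst S. (f p, f q) \<in> V} \<in> snd S)"

definition Unif :: "('p set \<times> ('p \<times> 'p) set set, 'p \<Rightarrow> 'p) cat" where
  "Unif = \<lparr> Obj = {S. uniform_structure (fst S) (snd S)},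
            Hom = (\<lambda>S T. {f \<in> fst S \<rightarrow>\<^sub>E fst T. uniform_map S T f}),
            Ident = (\<lambda>S. restrict id (fst S)),
            Comp = (\<lambda>S T U g f. compose (fst S) g f) \<rparr>"


section \<open>Coarse structure of a metric space\<close>

definition entourage :: "'a metric \<Rightarrow> ('a \<times> 'a) set \<Rightarrow> bool" where
  "entourage X E \<longleftrightarrow>
     E \<subseteq> mspace X \<times> mspace X \<and> bdd_above ((\<lambda>(x, y). mdist X x y) ` E)"

definition bounded_subset :: "'a metric \<Rightarrow> 'a set \<Rightarrow> bool" where
  "bounded_subset X B \<longleftrightarrow> B \<subseteq> mspace X \<and> entourage X (B \<times> B)"

definition coentourage :: "'a metric \<Rightarrow> ('a \<times> 'a) set \<Rightarrow> bool" where
  "coentourage X C \<longleftrightarrow>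
     C \<subseteq> mspace X \<times> mspace X \<and>
     (\<forall>x y :: nat \<Rightarrow> 'a. (\<forall>i. (x i, y i) \<in> C) \<longrightarrow>
        (bounded_subset X (range x) \<and> bounded_subset X (range y)) \<or>
        \<not> bdd_above (range (\<lambda>i. mdist X (x i) (y i))))"

definition ent_image :: "('a \<times> 'a) set \<Rightarrow> 'a set \<Rightarrow> 'a set" where
  "ent_image E A = {x. \<exists>a\<in>A. (x, a) \<in> E}"

definition close_subsets :: "'a metric \<Rightarrow> 'a set \<Rightarrow> 'a set \<Rightarrow> bool" where
  "close_subsets X A B \<longleftrightarrow>
     A \<subseteq> mspace X \<and> B \<subseteq> mspace X \<and> \<not> coentourage X (A \<times> B)"

text \<open>The values of a map outside the carrier of its domain are irrelevant to the following two
  notions; passing to closeness classes identifies maps that agree on the carrier.\<close>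

definition coarse_map :: "'a metric \<Rightarrow> 'b metric \<Rightarrow> ('a \<Rightarrow> 'b) \<Rightarrow> bool" where
  "coarse_map X Y f \<longleftrightarrow>
     f \<in> mspace X \<rightarrow> mspace Y \<and>
     (\<forall>E. entourage X E \<longrightarrow> entourage Y (map_prod f f ` E)) \<and>
     (\<forall>B. bounded_subset Y B \<longrightarrow> bounded_subset X {x \<in> mspace X. f x \<in> B})"

definition close_maps :: "'a metric \<Rightarrow> 'b metric \<Rightarrow> ('a \<Rightarrow> 'b) \<Rightarrow> ('a \<Rightarrow> 'b) \<Rightarrow> bool" where
  "close_maps X Y f g \<longleftrightarrow> entourage Y ((\<lambda>x. (f x, g x)) ` mspace X)"

definition closeness :: "'a metric \<Rightarrow> 'b metric \<Rightarrow> (('a \<Rightarrow> 'b) \<times> ('a \<Rightarrow> 'b)) set" where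
  "closeness X Y = {(f, g). coarse_map X Y f \<and> coarse_map X Y g \<and> close_maps X Y f g}"

abbreviation coarse_class :: "'a metric \<Rightarrow> 'b metric \<Rightarrow> ('a \<Rightarrow> 'b) \<Rightarrow> ('a \<Rightarrow> 'b) set" where
  "coarse_class X Y f \<equiv> closeness X Y `` {f}"

text \<open>The objects are all metric spaces whose carrier is a subset of the type \<open>'a\<close> (including the
  empty space). The type \<open>'a\<close> is arbitrary and plays the role of the universe: metric spaces
  over different types can be copied into a common one, such as the sum type.\<close>

definition mCoarse :: "('a metric, ('a \<Rightarrow> 'a) set) cat" where
  "mCoarse = \<lparr> Obj = UNIV,
               Hom = (\<lambda>X Y. {f. coarse_map X Y f} // closeness X Y),
               Ident = (\<lambda>X. coarse_class X X id),
               Comp = (\<lambda>X Y Z G F. \<Union>g\<in>G. \<Union>f\<in>F. coarse_class X Z (g \<circ> f)) \<rparr>"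


section \<open>The space of ends\<close>

text \<open>A coarse cover is a finite family of subsets; only the set of its members matters.\<close>

definition coarse_cover :: "'a metric \<Rightarrow> 'a set set \<Rightarrow> bool" where
  "coarse_cover X \<U> \<longleftrightarrow>
     finite \<U> \<and> (\<forall>U\<in>\<U>. U \<subseteq> mspace X) \<and>
     coentourage X (mspace X \<times> mspace X - (\<Union>U\<in>\<U>. U \<times> U))"

definition coarse_star :: "'a metric \<Rightarrow> 'a set \<Rightarrow> 'a set set \<Rightarrow> 'a set" where
  "coarse_star X S \<U> = \<Union>{U \<in> \<U>. close_subsets X S U}"

definition hausdorff_distance :: "'a metric \<Rightarrow> 'a set \<Rightarrow> 'a set \<Rightarrow> ennreal" where
  "hausdorff_distance X A B =
     max (SUP a\<in>A. INF b\<in>B. ennreal (mdist X a b)) (SUP b\<in>B. INF a\<in>A. ennreal (mdist X a b))"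

definition Zplus :: "nat metric" where
  "Zplus = metric (UNIV, \<lambda>m n. \<bar>real m - real n\<bar>)"

lemma Metric_space_Zplus: "Metric_space (UNIV :: nat set) (\<lambda>m n. \<bar>real m - real n\<bar>)"
  by unfold_locales auto

lemma mspace_Zplus [simp]: "mspace Zplus = UNIV"
  and mdist_Zplus [simp]: "mdist Zplus m n = \<bar>real m - real n\<bar>"
  by (simp_all add: Zplus_def Metric_space.mspace_metric [OF Metric_space_Zplus]
        Metric_space.mdist_metric [OF Metric_space_Zplus])

definition end_equiv :: "'a metric \<Rightarrow> ((nat \<Rightarrow> 'a) \<times> (nat \<Rightarrow> 'a)) set" where
  "end_equiv X = {(\<phi>, \<psi>). coarse_map Zplus X \<phi> \<and> coarse_map Zplus X \<psi> \<and>
                           hausdorff_distance X (range \<phi>) (range \<psi>) < \<infinity>}"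

abbreviation endpoint :: "'a metric \<Rightarrow> (nat \<Rightarrow> 'a) \<Rightarrow> (nat \<Rightarrow> 'a) set" where
  "endpoint X \<phi> \<equiv> end_equiv X `` {\<phi>}"

definition ends :: "'a metric \<Rightarrow> (nat \<Rightarrow> 'a) set set" where
  "ends X = {\<phi>. coarse_map Zplus X \<phi>} // end_equiv X"

text \<open>\<open>cover_rel X \<U>\<close> is \<open>D\<^sub>\<U>\<close>, so that \<open>\<U>[p]\<close> is \<open>cover_rel X \<U> `` {p}\<close>.\<close>

definition cover_rel :: "'a metric \<Rightarrow> 'a set set \<Rightarrow> ((nat \<Rightarrow> 'a) set \<times> (nat \<Rightarrow> 'a) set) set" where
  "cover_rel X \<U> = {(p, q) \<in> ends X \<times> ends X.
     \<exists>\<phi>\<in>p. \<exists>\<psi>\<in>q. \<exists>E. entourage X E \<and>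
       range \<psi> \<subseteq> ent_image E (coarse_star X (range \<phi>) \<U>) \<and>
       range \<phi> \<subseteq> ent_image E (coarse_star X (range \<psi>) \<U>)}"

definition ends_uniform ::
  "'a metric \<Rightarrow> (nat \<Rightarrow> 'a) set set \<times> ((nat \<Rightarrow> 'a) set \<times> (nat \<Rightarrow> 'a) set) set set" where
  "ends_uniform X =
     (ends X, {V. V \<subseteq> ends X \<times> ends X \<and> (\<exists>\<U>. coarse_cover X \<U> \<and> cover_rel X \<U> \<subseteq> V)})"

definition ends_open :: "'a metric \<Rightarrow> (nat \<Rightarrow> 'a) set set \<Rightarrow> bool" where
  "ends_open X W \<longleftrightarrow>
     W \<subseteq> ends X \<and> (\<forall>p\<in>W. \<exists>\<U>. coarse_cover X \<U> \<and> cover_rel X \<U> `` {p} \<subseteq> W)"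

text \<open>The constructor \<open>topology\<close> is only meaningful on families of sets satisfying
  \<open>istopology\<close>; that \<open>ends_open X\<close> does so has to be established separately.\<close>

definition ends_topology :: "'a metric \<Rightarrow> (nat \<Rightarrow> 'a) set topology" where
  "ends_topology X = topology (ends_open X)"

text \<open>The action on a closeness class \<open>F\<close> of maps and an endpoint \<open>p\<close> is the union of the
  classes \<open>[f \<circ> \<phi>]\<close> over all representatives; it is a single such class exactly when the
  class does not depend on the choice of representatives.\<close>

definition ends_map ::
  "'a metric \<Rightarrow> 'b metric \<Rightarrow> ('a \<Rightarrow> 'b) set \<Rightarrow> (nat \<Rightarrow> 'a) set \<Rightarrow> (nat \<Rightarrow> 'b) set" where
  "ends_map X Y F = (\<lambda>p\<in>ends X. \<Union>f\<in>F. \<Union>\<phi>\<in>p. endpoint Y (f \<circ> \<phi>))"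

end

theory Submission
  imports Defs
begin

text \<open>Closeness of subsets behaves like the proximity of a compact Hausdorff space at infinity:
  think of a subset as its set of limit points there, so that two subsets are close when these
  limit sets meet and \<open>B\<close> lies within finite distance of \<open>A\<close> when the limit set of \<open>B\<close> is contained
  in that of \<open>A\<close>. A coarse cover \<open>\<U>\<close> gives a neighbourhood \<open>\<Union>U \<times> U\<close> of the diagonal, an endpoint
  is a nonempty closed set, and \<open>D\<^sub>\<U>\<close> is the entourage of the Hausdorff uniformity on closed sets
  that belongs to this neighbourhood. This picture explains why the theorem holds; the
  proofs work with the proximity itself: closeness is additive in finite unions, depends on a set only up
  to finite distance (\<open>close_subsets_coarsely_within\<close>) and satisfies the normality axiom
  (\<open>not_close_subsets_separate\<close>).

  The crux is that the relations \<open>D\<^sub>\<U>\<close> can be halved. Compactness is replaced by a finite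
  combinatorial argument. A coarse cover \<open>\<U>\<close> amounts to finitely many pairs \<open>(A, B)\<close> of sets that
  are not close, whose products make up the complement of \<open>\<Union>U \<times> U\<close>. Each such pair is taken
  care of by a coarse cover of three sets, obtained from normality, in which \<open>V \<times> W\<close> avoids
  \<open>A \<times> B\<close> whenever \<open>V\<close> and \<open>W\<close> are close. A common refinement \<open>\<W>\<close> satisfies
  \<open>V \<times> W \<subseteq> \<Union>U \<times> U\<close> for all close members \<open>V\<close> and \<open>W\<close> (\<open>coarse_cover_star_refinement\<close>), and this
  is enough for the \<open>\<W>\<close>-star of a set near the \<open>\<W>\<close>-star of \<open>A\<close> to lie in the \<open>\<U>\<close>-star of \<open>A\<close>
  (\<open>coarse_star_star_refinement\<close>).

  Functoriality is formal. A coarse map \<open>f\<close> preserves closeness and finite distance, and pulls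
  coarse covers back to coarse covers; hence it maps the star of \<open>A\<close> with respect to a pulled
  back cover into the star of \<open>f ` A\<close>, which gives uniform continuity, and with it
  continuity.\<close>

section \<open>Bounded sets and coentourages\<close>

lemma mdist_self [simp]: "x \<in> mspace X \<Longrightarrow> mdist X x x = 0"
  by simp

lemma entourage_iff:
  "entourage X E \<longleftrightarrow> E \<subseteq> mspace X \<times> mspace X \<and> (\<exists>r. \<forall>(x, y)\<in>E. mdist X x y \<le> r)"
  by (auto simp: entourage_def bdd_above_def)

lemma bounded_subset_iff_mbounded:
  "bounded_subset X B \<longleftrightarrow> Metric_space.mbounded (mspace X) (mdist X) B"
proof -
  interpret Metric_space "mspace X" "mdist X"
    by simp
  show ?thesis
    by (auto simp: bounded_subset_def entourage_iff mbounded_alt)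
qed

lemma bounded_subset_mono: "bounded_subset X B \<Longrightarrow> A \<subseteq> B \<Longrightarrow> bounded_subset X A"
  by (metis Metric_space.mbounded_subset Metric_space_mspace_mdist bounded_subset_iff_mbounded)

lemma bounded_subset_Un:
  "bounded_subset X A \<Longrightarrow> bounded_subset X B \<Longrightarrow> bounded_subset X (A \<union> B)"
  by (metis Metric_space.mbounded_Un Metric_space_mspace_mdist bounded_subset_iff_mbounded)

lemma bounded_subset_empty: "bounded_subset X {}"
  by (simp add: bounded_subset_def entourage_def)

lemma bounded_subset_iff_center:
  assumes "c \<in> mspace X"
  shows "bounded_subset X B \<longleftrightarrow> B \<subseteq> mspace X \<and> (\<exists>r. \<forall>x\<in>B. mdist X c x \<le> r)"
proof
  assume B: "bounded_subset X B"
  have "bounded_subset X {c}"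
    using assms by (auto simp: bounded_subset_def entourage_iff)
  then have "bounded_subset X (insert c B)"
    using bounded_subset_Un[OF _ B, of "{c}"] by simp
  then obtain r where "insert c B \<subseteq> mspace X"
      "\<forall>(x, y)\<in>insert c B \<times> insert c B. mdist X x y \<le> r"
    unfolding bounded_subset_def entourage_iff by blast
  then show "B \<subseteq> mspace X \<and> (\<exists>r. \<forall>x\<in>B. mdist X c x \<le> r)"
    by blast
next
  assume "B \<subseteq> mspace X \<and> (\<exists>r. \<forall>x\<in>B. mdist X c x \<le> r)"
  then obtain r where B: "B \<subseteq> mspace X" and r: "\<And>x. x \<in> B \<Longrightarrow> mdist X c x \<le> r"
    by blast
  have "mdist X x y \<le> r + r" if "x \<in> B" "y \<in> B" for x y
    using mdist_triangle[of x X c y] r[OF that(1)] r[OF that(2)] assms B that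
      mdist_commute[of X x c] by fastforce
  then show "bounded_subset X B"
    using B by (auto simp: bounded_subset_def entourage_iff intro!: exI[of _ "r + r"])
qed

lemma bounded_subset_thickening:
  assumes "bounded_subset X K"
  shows "bounded_subset X {y \<in> mspace X. \<exists>x\<in>K. mdist X x y \<le> r}"
proof (cases "K = {}")
  case True
  then show ?thesis by (simp add: bounded_subset_empty)
next
  case False
  then obtain c where c: "c \<in> K" by blast
  have K: "K \<subseteq> mspace X"
    using assms by (simp add: bounded_subset_def)
  with c have cX: "c \<in> mspace X" by blast
  obtain s where s: "\<And>x. x \<in> K \<Longrightarrow> mdist X c x \<le> s"
    using assms cX by (auto simp: bounded_subset_iff_center)
  have "mdist X c y \<le> s + r" if "y \<in> mspace X" "x \<in> K" "mdist X x y \<le> r" for x y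
    using mdist_triangle[of c X x y] s[OF that(2)] that cX K by fastforce
  then show ?thesis
    using cX by (auto simp: bounded_subset_iff_center intro!: exI[of _ "s + r"])
qed

text \<open>If no bounded set works for some \<open>r\<close>, pairs in \<open>C\<close> leaving larger and larger balls form a
  sequence that contradicts the sequential definition.\<close>

lemma coentourage_iff:
  "coentourage X C \<longleftrightarrow> C \<subseteq> mspace X \<times> mspace X \<and>
     (\<forall>r. \<exists>K. bounded_subset X K \<and> (\<forall>(x, y)\<in>C. mdist X x y \<le> r \<longrightarrow> x \<in> K \<and> y \<in> K))"
  (is "_ \<longleftrightarrow> _ \<and> ?R")
proof (intro iffI conjI)
  assume "coentourage X C"
  then show CX: "C \<subseteq> mspace X \<times> mspace X"
    by (simp add: coentourage_def)
  show ?R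
  proof (rule ccontr)
    assume "\<not> ?R"
    then obtain r where nr: "\<not> (\<exists>K. bounded_subset X K \<and>
        (\<forall>(x, y)\<in>C. mdist X x y \<le> r \<longrightarrow> x \<in> K \<and> y \<in> K))"
      by (rule exE[OF iffD1[OF not_all]])
    have r: "\<exists>x y. (x, y) \<in> C \<and> mdist X x y \<le> r \<and> \<not> (x \<in> K \<and> y \<in> K)"
      if "bounded_subset X K" for K
      using nr that by auto
    from r[OF bounded_subset_empty] obtain c where c: "c \<in> mspace X"
      using CX by blast
    have "bounded_subset X {x \<in> mspace X. mdist X c x \<le> real n}" for n :: nat
      using c by (auto simp: bounded_subset_iff_center)
    from r[OF this] have "\<forall>n. \<exists>x y. (x, y) \<in> C \<and> mdist X x y \<le> r \<and>
        \<not> (mdist X c x \<le> real n \<and> mdist X c y \<le> real n)"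
      using CX by blast
    then obtain x y where xy: "\<And>n. (x n, y n) \<in> C" "\<And>n. mdist X (x n) (y n) \<le> r"
        "\<And>n::nat. \<not> (mdist X c (x n) \<le> real n \<and> mdist X c (y n) \<le> real n)"
      by metis
    have "bdd_above (range (\<lambda>i. mdist X (x i) (y i)))"
      using xy(2) by (auto intro!: bdd_aboveI)
    then have "bounded_subset X (range x)" "bounded_subset X (range y)"
      using \<open>coentourage X C\<close> xy(1) by (auto simp: coentourage_def)
    then obtain s t where "\<And>n. mdist X c (x n) \<le> s" "\<And>n. mdist X c (y n) \<le> t"
      using c by (auto simp: bounded_subset_iff_center)
    moreover obtain n :: nat where "max s t \<le> real n"
      using real_arch_simple by blast
    ultimately show False
      using xy(3)[of n] by (meson max.bounded_iff order_trans)
  qed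
next
  assume C: "C \<subseteq> mspace X \<times> mspace X \<and> ?R"
  show "coentourage X C"
    unfolding coentourage_def
  proof (intro conjI allI impI)
    show "C \<subseteq> mspace X \<times> mspace X" using C by blast
    fix x y :: "nat \<Rightarrow> 'a"
    assume xy: "\<forall>i. (x i, y i) \<in> C"
    show "bounded_subset X (range x) \<and> bounded_subset X (range y) \<or>
        \<not> bdd_above (range (\<lambda>i. mdist X (x i) (y i)))"
    proof (rule disjCI)
      assume "\<not> \<not> bdd_above (range (\<lambda>i. mdist X (x i) (y i)))"
      then obtain r where "\<And>i. mdist X (x i) (y i) \<le> r"
        by (auto simp: bdd_above_def)
      moreover obtain K where "bounded_subset X K"
          "\<forall>(x, y)\<in>C. mdist X x y \<le> r \<longrightarrow> x \<in> K \<and> y \<in> K"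
        using C by blast
      ultimately have "range x \<subseteq> K" "range y \<subseteq> K"
        using xy by blast+
      then show "bounded_subset X (range x) \<and> bounded_subset X (range y)"
        using \<open>bounded_subset X K\<close> bounded_subset_mono by blast
    qed
  qed
qed

lemma coentourage_mono: "coentourage X D \<Longrightarrow> C \<subseteq> D \<Longrightarrow> coentourage X C"
  unfolding coentourage_iff by (meson subsetD subset_trans)

lemma coentourage_Un:
  assumes "coentourage X C" "coentourage X D"
  shows "coentourage X (C \<union> D)"
  unfolding coentourage_iff
proof (intro conjI allI)
  show "C \<union> D \<subseteq> mspace X \<times> mspace X"
    using assms by (simp add: coentourage_iff)
  fix r
  obtain K where K: "bounded_subset X K"
      "\<forall>(x, y)\<in>C. mdist X x y \<le> r \<longrightarrow> x \<in> K \<and> y \<in> K"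
    using assms(1) unfolding coentourage_iff by blast
  obtain L where L: "bounded_subset X L"
      "\<forall>(x, y)\<in>D. mdist X x y \<le> r \<longrightarrow> x \<in> L \<and> y \<in> L"
    using assms(2) unfolding coentourage_iff by blast
  show "\<exists>K. bounded_subset X K \<and> (\<forall>(x, y)\<in>C \<union> D. mdist X x y \<le> r \<longrightarrow> x \<in> K \<and> y \<in> K)"
    using K L bounded_subset_Un[OF K(1) L(1)] by blast
qed

lemma coentourage_converse:
  assumes "coentourage X C"
  shows "coentourage X (C\<inverse>)"
  unfolding coentourage_iff
proof (intro conjI allI)
  show "C\<inverse> \<subseteq> mspace X \<times> mspace X"
    using assms by (auto simp: coentourage_iff)
  fix r
  obtain K where K: "bounded_subset X K"
      "\<forall>(x, y)\<in>C. mdist X x y \<le> r \<longrightarrow> x \<in> K \<and> y \<in> K"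
    using assms unfolding coentourage_iff by blast
  have "\<forall>(x, y)\<in>C\<inverse>. mdist X x y \<le> r \<longrightarrow> x \<in> K \<and> y \<in> K"
  proof clarify
    fix x y
    assume "(y, x) \<in> C" "mdist X x y \<le> r"
    then show "x \<in> K \<and> y \<in> K"
      using K(2) mdist_commute[of X x y] by auto
  qed
  then show "\<exists>K. bounded_subset X K \<and> (\<forall>(x, y)\<in>C\<inverse>. mdist X x y \<le> r \<longrightarrow> x \<in> K \<and> y \<in> K)"
    using K(1) by blast
qed

text \<open>It suffices to bound the first entry of a pair: the second one is at distance at most \<open>r\<close>
  from it, so it lies in a thickening of the same bounded set.\<close>

lemma coentourageI_left:
  assumes "C \<subseteq> mspace X \<times> mspace X"
    and "\<And>r. \<exists>K. bounded_subset X K \<and> (\<forall>(x, y)\<in>C. mdist X x y \<le> r \<longrightarrow> x \<in> K)"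
  shows "coentourage X C"
  unfolding coentourage_iff
proof (intro conjI allI)
  fix r
  obtain K where K: "bounded_subset X K" "\<forall>(x, y)\<in>C. mdist X x y \<le> r \<longrightarrow> x \<in> K"
    using assms(2) by blast
  let ?L = "K \<union> {y \<in> mspace X. \<exists>x\<in>K. mdist X x y \<le> r}"
  have "bounded_subset X ?L"
    by (rule bounded_subset_Un[OF K(1) bounded_subset_thickening[OF K(1)]])
  moreover have "\<forall>(x, y)\<in>C. mdist X x y \<le> r \<longrightarrow> x \<in> ?L \<and> y \<in> ?L"
    using K(2) assms(1) by blast
  ultimately show "\<exists>K. bounded_subset X K \<and> (\<forall>(x, y)\<in>C. mdist X x y \<le> r \<longrightarrow> x \<in> K \<and> y \<in> K)"
    by blast
qed (rule assms(1))


section \<open>Closeness of subsets as a proximity\<close>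

lemma close_subsets_iff:
  "close_subsets X A B \<longleftrightarrow> A \<subseteq> mspace X \<and> B \<subseteq> mspace X \<and>
     \<not> (\<forall>r. \<exists>K. bounded_subset X K \<and> (\<forall>a\<in>A. \<forall>b\<in>B. mdist X a b \<le> r \<longrightarrow> a \<in> K \<and> b \<in> K))"
  unfolding close_subsets_def coentourage_iff by auto

lemma close_subsets_sym: "close_subsets X A B \<longleftrightarrow> close_subsets X B A"
proof -
  have "(A \<times> B)\<inverse> = B \<times> A" "(B \<times> A)\<inverse> = A \<times> B"
    by auto
  then show ?thesis
    using coentourage_converse[of X "A \<times> B"] coentourage_converse[of X "B \<times> A"]
    by (auto simp: close_subsets_def)
qed

lemma close_subsets_Un:
  assumes "close_subsets X A (B \<union> C)"
  shows "close_subsets X A B \<or> close_subsets X A C"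
proof -
  have "coentourage X (A \<times> (B \<union> C))" if "coentourage X (A \<times> B)" "coentourage X (A \<times> C)"
    using coentourage_Un[OF that] by (simp add: Sigma_Un_distrib2)
  then show ?thesis
    using assms by (auto simp: close_subsets_def)
qed

lemma not_close_subsets_empty: "\<not> close_subsets X A {}"
  using bounded_subset_empty by (auto simp: close_subsets_iff)

lemma close_subsets_Union:
  "finite \<F> \<Longrightarrow> close_subsets X A (\<Union>\<F>) \<Longrightarrow> \<exists>B\<in>\<F>. close_subsets X A B"
proof (induction \<F> rule: finite_induct)
  case empty
  then show ?case by (simp add: not_close_subsets_empty)
next
  case (insert B \<F>)
  then show ?case
    using close_subsets_Un[of X A B "\<Union>\<F>"] by auto
qed

definition coarsely_within :: "'a metric \<Rightarrow> 'a set \<Rightarrow> 'a set \<Rightarrow> bool" where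
  "coarsely_within X A B \<longleftrightarrow>
     A \<subseteq> mspace X \<and> B \<subseteq> mspace X \<and> (\<exists>r. \<forall>a\<in>A. \<exists>b\<in>B. mdist X a b \<le> r)"

lemma coarsely_within_subset: "A \<subseteq> B \<Longrightarrow> B \<subseteq> mspace X \<Longrightarrow> coarsely_within X A B"
  unfolding coarsely_within_def by (metis mdist_self order_refl subset_iff)

lemma coarsely_within_trans:
  assumes "coarsely_within X A B" "coarsely_within X B C"
  shows "coarsely_within X A C"
proof -
  obtain r s where
    "\<And>a. a \<in> A \<Longrightarrow> \<exists>b\<in>B. mdist X a b \<le> r" "\<And>b. b \<in> B \<Longrightarrow> \<exists>c\<in>C. mdist X b c \<le> s"
    using assms unfolding coarsely_within_def by metis
  moreover have sub: "A \<subseteq> mspace X" "B \<subseteq> mspace X" "C \<subseteq> mspace X"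
    using assms by (auto simp: coarsely_within_def)
  ultimately have "\<exists>c\<in>C. mdist X a c \<le> r + s" if "a \<in> A" for a
    using that mdist_triangle[of a X] by (meson add_mono order_trans subsetD)
  then show ?thesis
    using sub unfolding coarsely_within_def by blast
qed

lemma ent_image_iff_coarsely_within:
  assumes "A \<subseteq> mspace X" "B \<subseteq> mspace X"
  shows "(\<exists>E. entourage X E \<and> A \<subseteq> ent_image E B) \<longleftrightarrow> coarsely_within X A B"
proof
  assume "\<exists>E. entourage X E \<and> A \<subseteq> ent_image E B"
  then show "coarsely_within X A B"
    using assms unfolding entourage_iff coarsely_within_def ent_image_def by blast
next
  assume "coarsely_within X A B"
  then obtain r where r: "\<And>a. a \<in> A \<Longrightarrow> \<exists>b\<in>B. mdist X a b \<le> r"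
    unfolding coarsely_within_def by blast
  let ?E = "{(x, y). x \<in> mspace X \<and> y \<in> mspace X \<and> mdist X x y \<le> r}"
  have "entourage X ?E"
    by (auto simp: entourage_iff)
  moreover have "A \<subseteq> ent_image ?E B"
    using r assms unfolding ent_image_def by blast
  ultimately show "\<exists>E. entourage X E \<and> A \<subseteq> ent_image E B" by blast
qed

text \<open>Moving a point of \<open>A\<close> by at most \<open>s\<close> into \<open>A'\<close> turns a pair at distance \<open>r\<close> into one at
  distance at most \<open>s + r\<close>, so a bound for \<open>A'\<close> and \<open>B\<close> at scale \<open>s + r\<close> serves \<open>A\<close> and \<open>B\<close> at
  scale \<open>r\<close>.\<close>

lemma close_subsets_coarsely_within:
  assumes "close_subsets X A B" "coarsely_within X A A'"
  shows "close_subsets X A' B"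
proof (rule ccontr)
  assume "\<not> close_subsets X A' B"
  moreover have sub: "A \<subseteq> mspace X" "B \<subseteq> mspace X" "A' \<subseteq> mspace X"
    using assms by (auto simp: close_subsets_def coarsely_within_def)
  ultimately have bd: "\<And>r. \<exists>K. bounded_subset X K \<and>
      (\<forall>a\<in>A'. \<forall>b\<in>B. mdist X a b \<le> r \<longrightarrow> a \<in> K \<and> b \<in> K)"
    unfolding close_subsets_iff by blast
  obtain s where s: "\<And>a. a \<in> A \<Longrightarrow> \<exists>a'\<in>A'. mdist X a a' \<le> s"
    using assms(2) unfolding coarsely_within_def by blast
  have "coentourage X (B \<times> A)"
  proof (rule coentourageI_left)
    show "B \<times> A \<subseteq> mspace X \<times> mspace X" using sub by blast
    fix r
    obtain K where K: "bounded_subset X K"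
        "\<forall>a\<in>A'. \<forall>b\<in>B. mdist X a b \<le> s + r \<longrightarrow> a \<in> K \<and> b \<in> K"
      using bd by blast
    have "b \<in> K" if b: "b \<in> B" and a: "a \<in> A" and "mdist X b a \<le> r" for a b
    proof -
      obtain a' where a': "a' \<in> A'" "mdist X a a' \<le> s"
        using s[OF a] by blast
      have "mdist X a' b \<le> mdist X a' a + mdist X a b"
        using sub a a' b by (intro mdist_triangle) auto
      then have "mdist X a' b \<le> s + r"
        using a'(2) that(3) mdist_commute[of X a' a] mdist_commute[of X a b] by simp
      then show "b \<in> K" using K(2) a' b by blast
    qed
    then show "\<exists>K. bounded_subset X K \<and> (\<forall>(x, y)\<in>B \<times> A. mdist X x y \<le> r \<longrightarrow> x \<in> K)"
      using K(1) by blast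
  qed
  then show False
    using assms(1) close_subsets_sym[of X A B] by (simp add: close_subsets_def)
qed

lemma close_subsets_mono:
  assumes "close_subsets X A B" "A \<subseteq> A'" "B \<subseteq> B'" "A' \<subseteq> mspace X" "B' \<subseteq> mspace X"
  shows "close_subsets X A' B'"
  using assms coentourage_mono[of X "A' \<times> B'" "A \<times> B"] by (auto simp: close_subsets_def)

text \<open>The normality axiom of a proximity: the bisecting set consists of the points that are
  at least as near to \<open>B\<close> as to \<open>A\<close>. It avoids distances to sets, which would require the
  empty set to be treated apart. A point of \<open>D\<close> near \<open>A\<close> is also near \<open>B\<close>, and symmetrically
  for a point near \<open>B\<close> outside \<open>D\<close>; either way it lies in a bounded set.\<close>

lemma not_close_subsets_separate:
  assumes nc: "\<not> close_subsets X A B" and sub: "A \<subseteq> mspace X" "B \<subseteq> mspace X"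
  obtains D where "D \<subseteq> mspace X" "\<not> close_subsets X A D" "\<not> close_subsets X (mspace X - D) B"
proof -
  let ?D = "{x \<in> mspace X. \<exists>b\<in>B. \<forall>a\<in>A. mdist X x b \<le> mdist X x a}"
  have bd: "\<And>r. \<exists>K. bounded_subset X K \<and> (\<forall>a\<in>A. \<forall>b\<in>B. mdist X a b \<le> r \<longrightarrow> a \<in> K \<and> b \<in> K)"
    using assms unfolding close_subsets_iff by blast
  have "coentourage X (A \<times> ?D)"
  proof (rule coentourageI_left)
    fix r
    obtain K where K: "bounded_subset X K"
        "\<forall>a\<in>A. \<forall>b\<in>B. mdist X a b \<le> r + r \<longrightarrow> a \<in> K \<and> b \<in> K"
      using bd by blast
    have "a \<in> K" if a: "a \<in> A" and x: "x \<in> ?D" and ax: "mdist X a x \<le> r" for a x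
    proof -
      obtain b where b: "b \<in> B" "mdist X x b \<le> mdist X x a"
        using a x by blast
      have "mdist X a b \<le> mdist X a x + mdist X x b"
        using a b x sub by (intro mdist_triangle) auto
      then have "mdist X a b \<le> r + r"
        using ax b(2) mdist_commute[of X a x] by simp
      then show "a \<in> K" using K(2) a b by blast
    qed
    then show "\<exists>K. bounded_subset X K \<and> (\<forall>(x, y)\<in>A \<times> ?D. mdist X x y \<le> r \<longrightarrow> x \<in> K)"
      using K(1) by blast
  qed (use sub in auto)
  moreover have "coentourage X (B \<times> (mspace X - ?D))"
  proof (rule coentourageI_left)
    fix r
    obtain K where K: "bounded_subset X K"
        "\<forall>a\<in>A. \<forall>b\<in>B. mdist X a b \<le> r + r \<longrightarrow> a \<in> K \<and> b \<in> K"
      using bd by blast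
    have "b \<in> K" if b: "b \<in> B" and x: "x \<in> mspace X - ?D" and bx: "mdist X b x \<le> r" for b x
    proof -
      obtain a where a: "a \<in> A" "mdist X x a < mdist X x b"
        using b x by (auto simp: not_le)
      have "mdist X a b \<le> mdist X a x + mdist X x b"
        using a b x sub by (intro mdist_triangle) auto
      then have "mdist X a b \<le> r + r"
        using bx a(2) mdist_commute[of X a x] mdist_commute[of X b x] by simp
      then show "b \<in> K" using K(2) a b by blast
    qed
    then show "\<exists>K. bounded_subset X K \<and>
        (\<forall>(x, y)\<in>B \<times> (mspace X - ?D). mdist X x y \<le> r \<longrightarrow> x \<in> K)"
      using K(1) by blast
  qed (use sub in auto)
  ultimately show ?thesis
    using that[of ?D] close_subsets_sym[of X "mspace X - ?D" B] by (auto simp: close_subsets_def)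
qed


section \<open>Refinement of coarse covers\<close>

lemma coarse_cover_iff:
  "coarse_cover X \<U> \<longleftrightarrow> finite \<U> \<and> (\<forall>U\<in>\<U>. U \<subseteq> mspace X) \<and>
     (\<forall>r. \<exists>K. bounded_subset X K \<and> (\<forall>x\<in>mspace X. \<forall>y\<in>mspace X.
        mdist X x y \<le> r \<and> (x \<notin> K \<or> y \<notin> K) \<longrightarrow> (\<exists>U\<in>\<U>. x \<in> U \<and> y \<in> U)))"
proof -
  have "(\<forall>(x, y)\<in>mspace X \<times> mspace X - (\<Union>U\<in>\<U>. U \<times> U). mdist X x y \<le> r \<longrightarrow> x \<in> K \<and> y \<in> K) \<longleftrightarrow>
      (\<forall>x\<in>mspace X. \<forall>y\<in>mspace X.
        mdist X x y \<le> r \<and> (x \<notin> K \<or> y \<notin> K) \<longrightarrow> (\<exists>U\<in>\<U>. x \<in> U \<and> y \<in> U))" for r K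
    by blast
  then show ?thesis
    unfolding coarse_cover_def coentourage_iff by simp
qed

text \<open>The members of \<open>\<U>\<close> need to be found only for pairs with both points outside \<open>K\<close>; enlarging
  \<open>K\<close> by \<open>r\<close> takes care of pairs with one point in \<open>K\<close>.\<close>

lemma coarse_coverI:
  assumes "finite \<U>" "\<And>U. U \<in> \<U> \<Longrightarrow> U \<subseteq> mspace X"
    and "\<And>r. \<exists>K. bounded_subset X K \<and> (\<forall>x\<in>mspace X. \<forall>y\<in>mspace X.
           mdist X x y \<le> r \<and> x \<notin> K \<and> y \<notin> K \<longrightarrow> (\<exists>U\<in>\<U>. x \<in> U \<and> y \<in> U))"
  shows "coarse_cover X \<U>"
  unfolding coarse_cover_def
proof (intro conjI)
  show "coentourage X (mspace X \<times> mspace X - (\<Union>U\<in>\<U>. U \<times> U))"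
  proof (rule coentourageI_left)
    fix r
    obtain K where K: "bounded_subset X K" "\<And>x y. x \<in> mspace X \<Longrightarrow> y \<in> mspace X \<Longrightarrow>
        mdist X x y \<le> r \<Longrightarrow> x \<notin> K \<Longrightarrow> y \<notin> K \<Longrightarrow> \<exists>U\<in>\<U>. x \<in> U \<and> y \<in> U"
      using assms(3)[of r] by blast
    let ?L = "K \<union> {x \<in> mspace X. \<exists>y\<in>K. mdist X y x \<le> r}"
    have "bounded_subset X ?L"
      by (rule bounded_subset_Un[OF K(1) bounded_subset_thickening[OF K(1)]])
    moreover have "x \<in> ?L" if "x \<in> mspace X" "y \<in> mspace X" "mdist X x y \<le> r"
        "\<not> (\<exists>U\<in>\<U>. x \<in> U \<and> y \<in> U)" for x y
      using K(2)[of x y] that mdist_commute[of X x y] by auto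
    ultimately show "\<exists>K. bounded_subset X K \<and>
        (\<forall>(x, y)\<in>mspace X \<times> mspace X - (\<Union>U\<in>\<U>. U \<times> U). mdist X x y \<le> r \<longrightarrow> x \<in> K)"
      by (intro exI[of _ ?L]) blast
  qed blast
qed (use assms in auto)

lemma coarse_cover_whole_space: "coarse_cover X {mspace X}"
  by (intro coarse_coverI) (auto intro: bounded_subset_empty)

lemma coarse_cover_common_refinement:
  assumes "coarse_cover X \<U>" "coarse_cover X \<V>"
  obtains \<W> where "coarse_cover X \<W>"
    "\<And>W. W \<in> \<W> \<Longrightarrow> \<exists>U\<in>\<U>. W \<subseteq> U" "\<And>W. W \<in> \<W> \<Longrightarrow> \<exists>V\<in>\<V>. W \<subseteq> V"
proof -
  let ?W = "(\<lambda>(U, V). U \<inter> V) ` (\<U> \<times> \<V>)"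
  have "coarse_cover X ?W"
  proof (rule coarse_coverI)
    fix r
    obtain K where K: "bounded_subset X K" "\<And>x y. x \<in> mspace X \<Longrightarrow> y \<in> mspace X \<Longrightarrow>
        mdist X x y \<le> r \<Longrightarrow> x \<notin> K \<or> y \<notin> K \<Longrightarrow> \<exists>U\<in>\<U>. x \<in> U \<and> y \<in> U"
      using assms(1) unfolding coarse_cover_iff by meson
    obtain L where L: "bounded_subset X L" "\<And>x y. x \<in> mspace X \<Longrightarrow> y \<in> mspace X \<Longrightarrow>
        mdist X x y \<le> r \<Longrightarrow> x \<notin> L \<or> y \<notin> L \<Longrightarrow> \<exists>U\<in>\<V>. x \<in> U \<and> y \<in> U"
      using assms(2) unfolding coarse_cover_iff by meson
    show "\<exists>K. bounded_subset X K \<and> (\<forall>x\<in>mspace X. \<forall>y\<in>mspace X.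
        mdist X x y \<le> r \<and> x \<notin> K \<and> y \<notin> K \<longrightarrow> (\<exists>U\<in>?W. x \<in> U \<and> y \<in> U))"
    proof (intro exI[of _ "K \<union> L"] conjI ballI impI)
      show "bounded_subset X (K \<union> L)"
        using K(1) L(1) by (rule bounded_subset_Un)
      fix x y
      assume "x \<in> mspace X" "y \<in> mspace X" "mdist X x y \<le> r \<and> x \<notin> K \<union> L \<and> y \<notin> K \<union> L"
      then obtain U V where "U \<in> \<U>" "x \<in> U" "y \<in> U" "V \<in> \<V>" "x \<in> V" "y \<in> V"
        using K(2)[of x y] L(2)[of x y] by blast
      then show "\<exists>U\<in>?W. x \<in> U \<and> y \<in> U" by force
    qed
  qed (use assms in \<open>auto simp: coarse_cover_def\<close>)
  then show ?thesis
    by (rule that) auto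
qed

text \<open>Separating twice gives \<open>P\<close> and \<open>Q\<close> that are not close, with \<open>P\<close> a coarse neighbourhood
  of \<open>A\<close> and \<open>Q\<close> one of \<open>B\<close>. Of the three sets \<open>P - B\<close>, \<open>X - (A \<union> B)\<close> and \<open>Q - A\<close> only the
  first meets \<open>A\<close> and only the last meets \<open>B\<close>, and these two are not close. Pairs at bounded
  distance lie in a common one of them, far away: in the first if \<open>A\<close> is involved, in the last
  if \<open>B\<close> is, and in the middle otherwise.\<close>

lemma not_close_subsets_coarse_cover:
  assumes nc: "\<not> close_subsets X A B" and sub: "A \<subseteq> mspace X" "B \<subseteq> mspace X"
  obtains \<W> where "coarse_cover X \<W>"
    "\<And>V W. V \<in> \<W> \<Longrightarrow> W \<in> \<W> \<Longrightarrow> close_subsets X V W \<Longrightarrow> (V \<times> W) \<inter> (A \<times> B) = {}"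
proof -
  obtain Q where Q: "Q \<subseteq> mspace X" "\<not> close_subsets X A Q" "\<not> close_subsets X (mspace X - Q) B"
    using not_close_subsets_separate[OF assms] .
  obtain D where D: "D \<subseteq> mspace X" "\<not> close_subsets X A D" "\<not> close_subsets X (mspace X - D) Q"
    using not_close_subsets_separate[OF Q(2) sub(1) Q(1)] .
  let ?P = "mspace X - D"
  let ?W = "{?P - B, mspace X - (A \<union> B), Q - A}"
  have "coarse_cover X ?W"
  proof (rule coarse_coverI)
    fix r :: real
    \<comment> \<open>A radius that is nonnegative makes the bounds below apply to a point paired with itself.\<close>
    let ?r = "max r 0"
    obtain K where K: "bounded_subset X K"
        "\<forall>a\<in>A. \<forall>b\<in>B. mdist X a b \<le> ?r \<longrightarrow> a \<in> K \<and> b \<in> K"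
      using nc sub unfolding close_subsets_iff by blast
    obtain L where L: "bounded_subset X L"
        "\<forall>a\<in>A. \<forall>b\<in>D. mdist X a b \<le> ?r \<longrightarrow> a \<in> L \<and> b \<in> L"
      using D(1,2) sub unfolding close_subsets_iff by blast
    obtain M where M: "bounded_subset X M"
        "\<forall>a\<in>mspace X - Q. \<forall>b\<in>B. mdist X a b \<le> ?r \<longrightarrow> a \<in> M \<and> b \<in> M"
      using Q(1,3) sub unfolding close_subsets_iff by blast
    show "\<exists>K. bounded_subset X K \<and> (\<forall>x\<in>mspace X. \<forall>y\<in>mspace X.
        mdist X x y \<le> r \<and> x \<notin> K \<and> y \<notin> K \<longrightarrow> (\<exists>U\<in>?W. x \<in> U \<and> y \<in> U))"
    proof (intro exI[of _ "K \<union> (L \<union> M)"] conjI ballI impI)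
      show "bounded_subset X (K \<union> (L \<union> M))"
        using K(1) L(1) M(1) by (intro bounded_subset_Un)
      fix x y
      assume x: "x \<in> mspace X" and y: "y \<in> mspace X"
        and xy: "mdist X x y \<le> r \<and> x \<notin> K \<union> (L \<union> M) \<and> y \<notin> K \<union> (L \<union> M)"
      have d: "mdist X x y \<le> ?r" "mdist X y x \<le> ?r" "mdist X x x \<le> ?r" "mdist X y y \<le> ?r"
        using xy x y mdist_commute[of X x y] by auto
      have near_A: "v \<in> ?P - B" if "u \<in> A" "v \<in> {x, y}" "mdist X u v \<le> ?r" for u v
        using that K(2) L(2) x y xy by blast
      have near_B: "v \<in> Q - A" if "u \<in> B" "v \<in> {x, y}" "mdist X v u \<le> ?r" for u v
        using that K(2) M(2) x y xy by blast
      consider "x \<in> A \<or> y \<in> A" | "x \<in> B \<or> y \<in> B" | "x \<notin> A \<union> B" "y \<notin> A \<union> B"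
        by blast
      then show "\<exists>U\<in>?W. x \<in> U \<and> y \<in> U"
      proof cases
        case 1
        then have "x \<in> ?P - B" "y \<in> ?P - B"
          using near_A[of x x] near_A[of x y] near_A[of y x] near_A[of y y] d by auto
        then show ?thesis by simp
      next
        case 2
        then have "x \<in> Q - A" "y \<in> Q - A"
          using near_B[of x x] near_B[of x y] near_B[of y x] near_B[of y y] d by auto
        then show ?thesis by simp
      next
        case 3
        then show ?thesis using x y by simp
      qed
    qed
  qed (use Q(1) in auto)
  moreover have "(V \<times> W) \<inter> (A \<times> B) = {}" if "V \<in> ?W" "W \<in> ?W" "close_subsets X V W" for V W
  proof (rule ccontr)
    assume "(V \<times> W) \<inter> (A \<times> B) \<noteq> {}"
    then have "V = ?P - B" "W = Q - A"
      using that(1,2) by auto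
    then have "close_subsets X ?P Q"
      using close_subsets_mono[OF that(3), of ?P Q] Q(1) by blast
    then show False using D(3) by simp
  qed
  ultimately show ?thesis by (rule that)
qed

lemma finite_not_close_coarse_cover:
  assumes "finite \<P>"
    and "\<And>A B. (A, B) \<in> \<P> \<Longrightarrow> A \<subseteq> mspace X \<and> B \<subseteq> mspace X \<and> \<not> close_subsets X A B"
  shows "\<exists>\<W>. coarse_cover X \<W> \<and> (\<forall>V\<in>\<W>. \<forall>W\<in>\<W>. close_subsets X V W \<longrightarrow>
           (\<forall>(A, B)\<in>\<P>. (V \<times> W) \<inter> (A \<times> B) = {}))"
  using assms
proof (induction \<P> rule: finite_induct)
  case empty
  then show ?case using coarse_cover_whole_space by blast
next
  case (insert AB \<P>)
  obtain A B where AB: "AB = (A, B)" by fastforce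
  obtain \<U> where U: "coarse_cover X \<U>"
      "\<And>V W. V \<in> \<U> \<Longrightarrow> W \<in> \<U> \<Longrightarrow> close_subsets X V W \<Longrightarrow> (V \<times> W) \<inter> (A \<times> B) = {}"
    using not_close_subsets_coarse_cover[of X A B] insert.prems[of A B] AB by blast
  have "\<exists>\<V>. coarse_cover X \<V> \<and> (\<forall>V\<in>\<V>. \<forall>W\<in>\<V>. close_subsets X V W \<longrightarrow>
           (\<forall>(A, B)\<in>\<P>. (V \<times> W) \<inter> (A \<times> B) = {}))"
    by (rule insert.IH, rule insert.prems) simp
  then obtain \<V> where V: "coarse_cover X \<V>"
      "\<And>V W. V \<in> \<V> \<Longrightarrow> W \<in> \<V> \<Longrightarrow> close_subsets X V W \<Longrightarrow>
         \<forall>(A, B)\<in>\<P>. (V \<times> W) \<inter> (A \<times> B) = {}"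
    by auto
  obtain \<W> where W: "coarse_cover X \<W>"
      "\<And>W. W \<in> \<W> \<Longrightarrow> \<exists>U\<in>\<U>. W \<subseteq> U" "\<And>W. W \<in> \<W> \<Longrightarrow> \<exists>V\<in>\<V>. W \<subseteq> V"
    using coarse_cover_common_refinement[OF U(1) V(1)] by blast
  have "(V \<times> W) \<inter> (C \<times> D) = {}"
    if VW: "V \<in> \<W>" "W \<in> \<W>" "close_subsets X V W" and CD: "(C, D) \<in> insert AB \<P>" for V W C D
  proof -
    obtain U1 U2 where U12: "U1 \<in> \<U>" "U2 \<in> \<U>" "V \<subseteq> U1" "W \<subseteq> U2"
      using W(2) VW by blast
    then have clU: "close_subsets X U1 U2"
      using close_subsets_mono[OF VW(3)] U(1) by (simp add: coarse_cover_def)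
    obtain V1 V2 where V12: "V1 \<in> \<V>" "V2 \<in> \<V>" "V \<subseteq> V1" "W \<subseteq> V2"
      using W(3) VW by blast
    then have clV: "close_subsets X V1 V2"
      using close_subsets_mono[OF VW(3)] V(1) by (simp add: coarse_cover_def)
    show ?thesis
    proof (cases "(C, D) = AB")
      case True
      then show ?thesis
        using AB U(2)[OF U12(1,2) clU] U12(3,4) by blast
    next
      case False
      then have "(V1 \<times> V2) \<inter> (C \<times> D) = {}"
        using CD V(2)[OF V12(1,2) clV] by auto
      then show ?thesis using V12(3,4) by blast
    qed
  qed
  then have "\<forall>V\<in>\<W>. \<forall>W\<in>\<W>. close_subsets X V W \<longrightarrow>
      (\<forall>(C, D)\<in>insert AB \<P>. (V \<times> W) \<inter> (C \<times> D) = {})"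
    by (intro ballI impI case_prodI2) metis
  then show ?case using W(1) by blast
qed

text \<open>Being in no common member of \<open>\<U>\<close> means being in \<open>A\<^sub>I \<times> B\<^sub>I\<close> for some subfamily \<open>I\<close>, where
  \<open>A\<^sub>I\<close> is the complement of \<open>\<Union>I\<close> and \<open>B\<^sub>I\<close> that of \<open>\<Union>(\<U> - I)\<close>; so \<open>\<U>\<close> is a coarse cover
  exactly when no \<open>A\<^sub>I\<close> is close to \<open>B\<^sub>I\<close>, and a coarse cover whose close members have products
  avoiding all \<open>A\<^sub>I \<times> B\<^sub>I\<close> is as required. The union of two close members of \<open>\<W>\<close>
  need not lie in a single member of \<open>\<U>\<close>: a coarse cover only controls pairs of points, and so
  does the conclusion.\<close>

lemma coarse_cover_star_refinement:
  assumes "coarse_cover X \<U>"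
  obtains \<W> where "coarse_cover X \<W>"
    "\<And>V W. V \<in> \<W> \<Longrightarrow> W \<in> \<W> \<Longrightarrow> close_subsets X V W \<Longrightarrow> V \<times> W \<subseteq> (\<Union>U\<in>\<U>. U \<times> U)"
proof -
  let ?A = "\<lambda>I. mspace X - \<Union>I"
  let ?P = "(\<lambda>I. (?A I, ?A (\<U> - I))) ` Pow \<U>"
  have "\<not> close_subsets X (?A I) (?A (\<U> - I))" for I
  proof -
    have "coentourage X (mspace X \<times> mspace X - (\<Union>U\<in>\<U>. U \<times> U))"
      using assms by (simp add: coarse_cover_def)
    then have "coentourage X (?A I \<times> ?A (\<U> - I))"
      by (rule coentourage_mono) blast
    then show ?thesis by (simp add: close_subsets_def)
  qed
  then have "A \<subseteq> mspace X \<and> B \<subseteq> mspace X \<and> \<not> close_subsets X A B" if "(A, B) \<in> ?P" for A B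
    using that by (elim imageE) simp
  moreover have "finite ?P"
    using assms by (simp add: coarse_cover_def)
  ultimately have "\<exists>\<W>. coarse_cover X \<W> \<and> (\<forall>V\<in>\<W>. \<forall>W\<in>\<W>. close_subsets X V W \<longrightarrow>
      (\<forall>(A, B)\<in>?P. (V \<times> W) \<inter> (A \<times> B) = {}))"
    by (rule finite_not_close_coarse_cover[rotated])
  then obtain \<W> where W: "coarse_cover X \<W>" and ref: "\<forall>V\<in>\<W>. \<forall>W\<in>\<W>. close_subsets X V W \<longrightarrow>
      (\<forall>(A, B)\<in>?P. (V \<times> W) \<inter> (A \<times> B) = {})"
    by (elim exE conjE)
  have "V \<times> W \<subseteq> (\<Union>U\<in>\<U>. U \<times> U)" if VW: "V \<in> \<W>" "W \<in> \<W>" "close_subsets X V W" for V W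
  proof (clarify, rule ccontr)
    fix x y
    assume xy: "x \<in> V" "y \<in> W" "(x, y) \<notin> (\<Union>U\<in>\<U>. U \<times> U)"
    let ?I = "{U \<in> \<U>. x \<notin> U}"
    have "x \<in> mspace X" "y \<in> mspace X"
      using xy VW W by (auto simp: coarse_cover_def)
    then have "(x, y) \<in> ?A ?I \<times> ?A (\<U> - ?I)"
      using xy by blast
    moreover have "(?A ?I, ?A (\<U> - ?I)) \<in> ?P"
      by (rule image_eqI[of _ _ ?I]) auto
    from bspec[OF mp[OF bspec[OF bspec[OF ref VW(1)] VW(2)] VW(3)] this]
    have "(V \<times> W) \<inter> (?A ?I \<times> ?A (\<U> - ?I)) = {}"
      by (simp only: prod.case)
    ultimately show False
      using xy(1,2) by blast
  qed
  then show ?thesis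
    using that[OF W] by blast
qed


section \<open>Coarse stars\<close>

lemma coarse_star_subset_mspace: "coarse_star X A \<U> \<subseteq> mspace X"
  by (auto simp: coarse_star_def close_subsets_def)

lemma coarse_star_coarsely_within:
  "coarsely_within X A B \<Longrightarrow> coarse_star X A \<U> \<subseteq> coarse_star X B \<U>"
  unfolding coarse_star_def using close_subsets_coarsely_within by blast

lemma coarse_star_refinement:
  assumes "\<And>W. W \<in> \<W> \<Longrightarrow> \<exists>U\<in>\<U>. W \<subseteq> U" "\<And>U. U \<in> \<U> \<Longrightarrow> U \<subseteq> mspace X"
  shows "coarse_star X A \<W> \<subseteq> coarse_star X A \<U>"
proof
  fix x
  assume "x \<in> coarse_star X A \<W>"
  then obtain W where W: "W \<in> \<W>" "close_subsets X A W" "x \<in> W"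
    by (auto simp: coarse_star_def)
  then obtain U where "U \<in> \<U>" "W \<subseteq> U"
    using assms(1) by blast
  moreover have "close_subsets X A U"
    using close_subsets_mono[OF W(2), of A U] W(2) calculation assms(2)
    by (auto simp: close_subsets_def)
  ultimately show "x \<in> coarse_star X A \<U>"
    using W(3) by (auto simp: coarse_star_def)
qed

text \<open>The members not close to \<open>A\<close> contain only a bounded part of \<open>A\<close>, because there are
  finitely many; the members together miss a bounded set. As \<open>A\<close> is unbounded, the star is not
  empty, and the missing bounded part is within finite distance of any of its points.\<close>

lemma coarsely_within_coarse_star_self:
  assumes U: "coarse_cover X \<U>" and A: "A \<subseteq> mspace X" "\<not> bounded_subset X A"
  shows "coarsely_within X A (coarse_star X A \<U>)"
proof -
  let ?S = "coarse_star X A \<U>"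
  let ?N = "\<Union>{U \<in> \<U>. \<not> close_subsets X A U}"
  have "\<not> close_subsets X A ?N"
    using close_subsets_Union[of "{U \<in> \<U>. \<not> close_subsets X A U}" X A] U
    by (auto simp: coarse_cover_def)
  moreover have "?N \<subseteq> mspace X"
    using U by (auto simp: coarse_cover_def)
  ultimately obtain K where K: "bounded_subset X K"
      "\<forall>a\<in>A. \<forall>b\<in>?N. mdist X a b \<le> 0 \<longrightarrow> a \<in> K \<and> b \<in> K"
    using A unfolding close_subsets_iff by blast
  obtain L where L: "bounded_subset X L"
      "\<And>x y. x \<in> mspace X \<Longrightarrow> y \<in> mspace X \<Longrightarrow> mdist X x y \<le> 0 \<Longrightarrow> x \<notin> L \<or> y \<notin> L \<Longrightarrow>
         \<exists>U\<in>\<U>. x \<in> U \<and> y \<in> U"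
    using U unfolding coarse_cover_iff by meson
  have KL: "bounded_subset X (K \<union> L)"
    using K(1) L(1) by (rule bounded_subset_Un)
  have in_S: "a \<in> ?S" if a: "a \<in> A" "a \<notin> K \<union> L" for a
  proof -
    have aX: "a \<in> mspace X" "mdist X a a \<le> 0"
      using a A by auto
    then obtain V where V: "V \<in> \<U>" "a \<in> V"
      using L(2)[of a a] a by blast
    then have "close_subsets X A V"
      using K(2) a aX by blast
    then show ?thesis
      using V by (auto simp: coarse_star_def)
  qed
  have "\<not> A \<subseteq> K \<union> L"
    using KL A(2) bounded_subset_mono by blast
  then obtain s where s: "s \<in> ?S"
    using in_S by blast
  then have sX: "s \<in> mspace X"
    using coarse_star_subset_mspace[of X A \<U>] by auto
  then obtain r where r: "\<And>x. x \<in> K \<union> L \<Longrightarrow> mdist X s x \<le> r"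
    using KL unfolding bounded_subset_iff_center[OF sX] by blast
  have "\<exists>b\<in>?S. mdist X a b \<le> max r 0" if "a \<in> A" for a
  proof (cases "a \<in> K \<union> L")
    case True
    then show ?thesis
      using r[of a] s mdist_commute[of X a s] by (intro bexI[of _ s]) auto
  next
    case False
    then show ?thesis
      using in_S[OF that] that A(1) mdist_self[of a X] by (intro bexI[of _ a]) auto
  qed
  then show ?thesis
    using A(1) coarse_star_subset_mspace[of X A \<U>] unfolding coarsely_within_def by blast
qed

text \<open>This is where pairwise control is enough. Suppose that \<open>V\<close> is close to \<open>B\<close>. As \<open>B\<close> is
  within the star of \<open>A\<close>, some \<open>W\<close> is close both to \<open>V\<close> and to \<open>A\<close>. A point \<open>x\<close> of \<open>V\<close> shares
  a member of \<open>\<U>\<close> with each point of \<open>W\<close>, so finitely many members containing \<open>x\<close> cover \<open>W\<close>,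
  and one of these is close to \<open>A\<close>.\<close>

lemma coarse_star_star_refinement:
  assumes U: "coarse_cover X \<U>" and W: "coarse_cover X \<W>"
    and ref: "\<And>V W. V \<in> \<W> \<Longrightarrow> W \<in> \<W> \<Longrightarrow> close_subsets X V W \<Longrightarrow> V \<times> W \<subseteq> (\<Union>U\<in>\<U>. U \<times> U)"
    and B: "coarsely_within X B (coarse_star X A \<W>)"
  shows "coarse_star X B \<W> \<subseteq> coarse_star X A \<U>"
proof
  fix x
  assume "x \<in> coarse_star X B \<W>"
  then obtain V where V: "V \<in> \<W>" "close_subsets X B V" "x \<in> V"
    by (auto simp: coarse_star_def)
  have "close_subsets X V (coarse_star X A \<W>)"
    using close_subsets_coarsely_within[OF V(2) B] by (simp add: close_subsets_sym)
  then obtain W where W': "W \<in> \<W>" "close_subsets X A W" "close_subsets X V W"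
    using close_subsets_Union[of "{W \<in> \<W>. close_subsets X A W}" X V] W
    by (auto simp: coarse_star_def coarse_cover_def)
  let ?F = "{U \<in> \<U>. x \<in> U}"
  have "W \<subseteq> \<Union>?F"
    using ref[OF V(1) W'(1,3)] V(3) by blast
  moreover have "\<Union>?F \<subseteq> mspace X"
    using U by (auto simp: coarse_cover_def)
  ultimately have "close_subsets X A (\<Union>?F)"
    using close_subsets_mono[OF W'(2), of A "\<Union>?F"] W'(2) by (auto simp: close_subsets_def)
  then obtain U' where "U' \<in> ?F" "close_subsets X A U'"
    using close_subsets_Union[of ?F X A] U by (auto simp: coarse_cover_def)
  then show "x \<in> coarse_star X A \<U>"
    by (auto simp: coarse_star_def)
qed


section \<open>Coarse maps and their closeness classes\<close>

lemma coarse_map_iff: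
  "coarse_map X Y f \<longleftrightarrow> f \<in> mspace X \<rightarrow> mspace Y \<and>
     (\<forall>r. \<exists>s. \<forall>x\<in>mspace X. \<forall>y\<in>mspace X. mdist X x y \<le> r \<longrightarrow> mdist Y (f x) (f y) \<le> s) \<and>
     (\<forall>B. bounded_subset Y B \<longrightarrow> bounded_subset X {x \<in> mspace X. f x \<in> B})"
proof -
  have "(\<forall>E. entourage X E \<longrightarrow> entourage Y (map_prod f f ` E)) \<longleftrightarrow>
      (\<forall>r. \<exists>s. \<forall>x\<in>mspace X. \<forall>y\<in>mspace X. mdist X x y \<le> r \<longrightarrow> mdist Y (f x) (f y) \<le> s)"
    (is "?L \<longleftrightarrow> ?R") if f: "f \<in> mspace X \<rightarrow> mspace Y"
  proof
    assume L: ?L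
    show ?R
    proof
      fix r
      let ?E = "{(x, y). x \<in> mspace X \<and> y \<in> mspace X \<and> mdist X x y \<le> r}"
      have "entourage X ?E"
        by (auto simp: entourage_iff)
      then have "entourage Y (map_prod f f ` ?E)"
        using L by simp
      then obtain s where "\<forall>(u, v)\<in>map_prod f f ` ?E. mdist Y u v \<le> s"
        by (auto simp: entourage_iff)
      then show "\<exists>s. \<forall>x\<in>mspace X. \<forall>y\<in>mspace X. mdist X x y \<le> r \<longrightarrow> mdist Y (f x) (f y) \<le> s"
        by (intro exI[of _ s]) auto
    qed
  next
    assume R: ?R
    show ?L
    proof (intro allI impI)
      fix E
      assume "entourage X E"
      then obtain r where E: "E \<subseteq> mspace X \<times> mspace X" "\<And>x y. (x, y) \<in> E \<Longrightarrow> mdist X x y \<le> r"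
        unfolding entourage_iff by blast
      obtain s where "\<forall>x\<in>mspace X. \<forall>y\<in>mspace X. mdist X x y \<le> r \<longrightarrow> mdist Y (f x) (f y) \<le> s"
        using R by blast
      then have "mdist Y (f x) (f y) \<le> s" if "(x, y) \<in> E" for x y
        using E that by blast
      moreover have "map_prod f f ` E \<subseteq> mspace Y \<times> mspace Y"
        using E(1) f by auto
      ultimately show "entourage Y (map_prod f f ` E)"
        by (auto simp: entourage_iff intro!: exI[of _ s])
    qed
  qed
  then show ?thesis
    unfolding coarse_map_def by blast
qed

lemma coarse_map_in_mspace: "coarse_map X Y f \<Longrightarrow> x \<in> mspace X \<Longrightarrow> f x \<in> mspace Y"
  by (auto simp: coarse_map_def)

lemma coarse_map_controlled:
  assumes "coarse_map X Y f"
  obtains s where "\<And>x y. x \<in> mspace X \<Longrightarrow> y \<in> mspace X \<Longrightarrow> mdist X x y \<le> r \<Longrightarrow>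
    mdist Y (f x) (f y) \<le> s"
proof -
  have "\<exists>s. \<forall>x\<in>mspace X. \<forall>y\<in>mspace X. mdist X x y \<le> r \<longrightarrow> mdist Y (f x) (f y) \<le> s"
    using assms by (simp add: coarse_map_iff)
  then show ?thesis using that by blast
qed

lemma coarse_map_id: "coarse_map X X id"
proof -
  have "bounded_subset X {x \<in> mspace X. id x \<in> B}" if "bounded_subset X B" for B
    using that by (rule bounded_subset_mono) auto
  then show ?thesis
    by (auto simp: coarse_map_iff)
qed

lemma coarse_map_comp:
  assumes f: "coarse_map X Y f" and g: "coarse_map Y Z g"
  shows "coarse_map X Z (g \<circ> f)"
  unfolding coarse_map_iff
proof (intro conjI allI impI)
  show "g \<circ> f \<in> mspace X \<rightarrow> mspace Z"
    using coarse_map_in_mspace[OF f] coarse_map_in_mspace[OF g] by auto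
  fix r
  obtain s where s: "\<And>x y. x \<in> mspace X \<Longrightarrow> y \<in> mspace X \<Longrightarrow> mdist X x y \<le> r \<Longrightarrow>
      mdist Y (f x) (f y) \<le> s"
    using coarse_map_controlled[OF f] by blast
  obtain t where "\<And>x y. x \<in> mspace Y \<Longrightarrow> y \<in> mspace Y \<Longrightarrow> mdist Y x y \<le> s \<Longrightarrow>
      mdist Z (g x) (g y) \<le> t"
    using coarse_map_controlled[OF g] by blast
  then show "\<exists>t. \<forall>x\<in>mspace X. \<forall>y\<in>mspace X. mdist X x y \<le> r \<longrightarrow>
      mdist Z ((g \<circ> f) x) ((g \<circ> f) y) \<le> t"
    using s coarse_map_in_mspace[OF f] by (intro exI[of _ t]) simp
next
  fix B
  assume "bounded_subset Z B"
  then have "bounded_subset Y {y \<in> mspace Y. g y \<in> B}"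
    using g by (simp add: coarse_map_iff)
  then have "bounded_subset X {x \<in> mspace X. f x \<in> {y \<in> mspace Y. g y \<in> B}}"
    using f unfolding coarse_map_iff by blast
  then show "bounded_subset X {x \<in> mspace X. (g \<circ> f) x \<in> B}"
    by (rule bounded_subset_mono) (use coarse_map_in_mspace[OF f] in auto)
qed

lemma closeness_iff:
  "(f, g) \<in> closeness X Y \<longleftrightarrow> coarse_map X Y f \<and> coarse_map X Y g \<and>
     (\<exists>s. \<forall>x\<in>mspace X. mdist Y (f x) (g x) \<le> s)"
proof -
  have "close_maps X Y f g \<longleftrightarrow> (\<exists>s. \<forall>x\<in>mspace X. mdist Y (f x) (g x) \<le> s)"
    if "coarse_map X Y f" "coarse_map X Y g"
    using coarse_map_in_mspace[OF that(1)] coarse_map_in_mspace[OF that(2)]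
    by (auto simp: close_maps_def entourage_iff)
  then show ?thesis by (auto simp: closeness_def)
qed

lemma equiv_closeness: "equiv {f. coarse_map X Y f} (closeness X Y)"
proof (rule equivI)
  show "closeness X Y \<subseteq> {f. coarse_map X Y f} \<times> {f. coarse_map X Y f}"
    by (auto simp: closeness_def)
  show "refl_on {f. coarse_map X Y f} (closeness X Y)"
  proof (rule refl_onI)
    fix f
    assume "f \<in> {f. coarse_map X Y f}"
    then show "(f, f) \<in> closeness X Y"
      using coarse_map_in_mspace[of X Y f] by (auto simp: closeness_iff intro!: exI[of _ 0])
  qed
  show "sym (closeness X Y)"
  proof (rule symI)
    fix f g
    assume "(f, g) \<in> closeness X Y"
    then show "(g, f) \<in> closeness X Y"
      by (auto simp: closeness_iff mdist_commute[of Y "g _"])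
  qed
  show "trans (closeness X Y)"
  proof (rule transI)
    fix f g h
    assume fg: "(f, g) \<in> closeness X Y" and gh: "(g, h) \<in> closeness X Y"
    then obtain s t where st: "\<And>x. x \<in> mspace X \<Longrightarrow> mdist Y (f x) (g x) \<le> s"
        "\<And>x. x \<in> mspace X \<Longrightarrow> mdist Y (g x) (h x) \<le> t"
      unfolding closeness_iff by blast
    have co: "coarse_map X Y f" "coarse_map X Y g" "coarse_map X Y h"
      using fg gh by (auto simp: closeness_iff)
    have "mdist Y (f x) (h x) \<le> s + t" if x: "x \<in> mspace X" for x
      using mdist_triangle[of "f x" Y "g x" "h x"] st[OF x] co[THEN coarse_map_in_mspace, OF x]
      by linarith
    then show "(f, h) \<in> closeness X Y"
      using co unfolding closeness_iff by blast
  qed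
qed

lemma closeness_comp:
  assumes "(f, f') \<in> closeness X Y" "(g, g') \<in> closeness Y Z"
  shows "(g \<circ> f, g' \<circ> f') \<in> closeness X Z"
proof -
  have f: "coarse_map X Y f" "coarse_map X Y f'" and g: "coarse_map Y Z g" "coarse_map Y Z g'"
    using assms by (auto simp: closeness_iff)
  obtain s where s: "\<And>x. x \<in> mspace X \<Longrightarrow> mdist Y (f x) (f' x) \<le> s"
    using assms(1) unfolding closeness_iff by blast
  obtain t where t: "\<And>x y. x \<in> mspace Y \<Longrightarrow> y \<in> mspace Y \<Longrightarrow> mdist Y x y \<le> s \<Longrightarrow>
      mdist Z (g x) (g y) \<le> t"
    using coarse_map_controlled[OF g(1)] by blast
  obtain u where u: "\<And>y. y \<in> mspace Y \<Longrightarrow> mdist Z (g y) (g' y) \<le> u"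
    using assms(2) unfolding closeness_iff by blast
  have "mdist Z (g (f x)) (g' (f' x)) \<le> t + u" if x: "x \<in> mspace X" for x
  proof -
    note fx = f[THEN coarse_map_in_mspace, OF x]
    have "mdist Z (g (f x)) (g' (f' x)) \<le>
        mdist Z (g (f x)) (g (f' x)) + mdist Z (g (f' x)) (g' (f' x))"
      using fx by (intro mdist_triangle coarse_map_in_mspace[OF g(1)] coarse_map_in_mspace[OF g(2)])
    then show ?thesis
      using t[OF fx s[OF x]] u[OF fx(2)] by linarith
  qed
  then show ?thesis
    using coarse_map_comp[OF f(1) g(1)] coarse_map_comp[OF f(2) g(2)]
    by (auto simp: closeness_iff)
qed

lemma coarse_class_self: "coarse_map X Y f \<Longrightarrow> f \<in> coarse_class X Y f"
  using equiv_class_self[OF equiv_closeness] by fastforce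

lemma coarse_class_comp:
  assumes "coarse_map X Y f" "coarse_map Y Z g"
  shows "(\<Union>g'\<in>coarse_class Y Z g. \<Union>f'\<in>coarse_class X Y f. coarse_class X Z (g' \<circ> f')) =
    coarse_class X Z (g \<circ> f)"
proof -
  have "coarse_class X Z (g' \<circ> f') = coarse_class X Z (g \<circ> f)"
    if "g' \<in> coarse_class Y Z g" "f' \<in> coarse_class X Y f" for f' g'
    using that closeness_comp[of f f' X Y g g' Z]
    by (intro equiv_class_eq[OF equiv_closeness, symmetric]) auto
  then show ?thesis
    using coarse_class_self[OF assms(1)] coarse_class_self[OF assms(2)] by blast
qed

lemma mCoarse_simps [simp]:
  "Obj mCoarse = UNIV"
  "Hom mCoarse X Y = {f. coarse_map X Y f} // closeness X Y"
  "Ident mCoarse X = coarse_class X X id"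
  by (simp_all add: mCoarse_def)

lemma mCoarse_homE:
  assumes "F \<in> {f. coarse_map X Y f} // closeness X Y"
  obtains f where "coarse_map X Y f" "F = coarse_class X Y f"
  using assms by (auto elim: quotientE)

lemma coarse_class_in_hom:
  "coarse_map X Y f \<Longrightarrow> coarse_class X Y f \<in> {f. coarse_map X Y f} // closeness X Y"
  by (simp add: quotientI)

lemma mCoarse_comp_class:
  assumes "coarse_map X Y f" "coarse_map Y Z g"
  shows "Comp mCoarse X Y Z (coarse_class Y Z g) (coarse_class X Y f) = coarse_class X Z (g \<circ> f)"
  using coarse_class_comp[OF assms] by (simp add: mCoarse_def)

lemma is_category_mCoarse: "is_category (mCoarse :: ('a metric, ('a \<Rightarrow> 'a) set) cat)"
proof (unfold_locales, goal_cases)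
  case (1 X)
  then show ?case by (simp add: coarse_class_in_hom coarse_map_id)
next
  case (2 X Y Z F G)
  then show ?case
    by (auto elim!: mCoarse_homE simp: mCoarse_comp_class coarse_class_in_hom coarse_map_comp)
next
  case (3 X Y F)
  then show ?case
    by (auto elim!: mCoarse_homE simp: mCoarse_comp_class coarse_map_id)
next
  case (4 X Y F)
  then show ?case
    by (auto elim!: mCoarse_homE simp: mCoarse_comp_class coarse_map_id)
next
  case (5 W X Y Z F G H)
  then show ?case
    by (auto elim!: mCoarse_homE simp: mCoarse_comp_class coarse_map_comp comp_assoc)
qed

lemma coarsely_within_image:
  assumes f: "coarse_map X Y f" and AB: "coarsely_within X A B"
  shows "coarsely_within Y (f ` A) (f ` B)"
proof -
  obtain r where r: "\<And>a. a \<in> A \<Longrightarrow> \<exists>b\<in>B. mdist X a b \<le> r"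
    using AB unfolding coarsely_within_def by blast
  have sub: "A \<subseteq> mspace X" "B \<subseteq> mspace X"
    using AB by (auto simp: coarsely_within_def)
  obtain s where s: "\<And>x y. x \<in> mspace X \<Longrightarrow> y \<in> mspace X \<Longrightarrow> mdist X x y \<le> r \<Longrightarrow>
      mdist Y (f x) (f y) \<le> s"
    using coarse_map_controlled[OF f] by blast
  have "\<exists>b\<in>f ` B. mdist Y (f a) b \<le> s" if "a \<in> A" for a
    using r[OF that] s sub that by blast
  moreover have "f ` A \<subseteq> mspace Y" "f ` B \<subseteq> mspace Y"
    using sub coarse_map_in_mspace[OF f] by auto
  ultimately show ?thesis
    unfolding coarsely_within_def by blast
qed

lemma close_maps_coarsely_within:
  assumes "(f, g) \<in> closeness X Y" "A \<subseteq> mspace X"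
  shows "coarsely_within Y (f ` A) (g ` A)"
proof -
  obtain s where "\<And>x. x \<in> mspace X \<Longrightarrow> mdist Y (f x) (g x) \<le> s"
    using assms(1) unfolding closeness_iff by blast
  moreover have "f ` A \<subseteq> mspace Y" "g ` A \<subseteq> mspace Y"
    using assms coarse_map_in_mspace[of X Y] by (auto simp: closeness_iff)
  ultimately show ?thesis
    using assms(2) unfolding coarsely_within_def by blast
qed

text \<open>Controlled pairs map to controlled pairs, and if these stayed in a bounded set then so would
  the original ones, because preimages of bounded sets are bounded.\<close>

lemma close_subsets_image:
  assumes f: "coarse_map X Y f" and AB: "close_subsets X A B"
  shows "close_subsets Y (f ` A) (f ` B)"
proof (rule ccontr)
  assume nc: "\<not> close_subsets Y (f ` A) (f ` B)"
  have sub: "A \<subseteq> mspace X" "B \<subseteq> mspace X"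
    using AB by (auto simp: close_subsets_def)
  then have "f ` A \<subseteq> mspace Y" "f ` B \<subseteq> mspace Y"
    using coarse_map_in_mspace[OF f] by auto
  then have bd: "\<And>s. \<exists>K. bounded_subset Y K \<and>
      (\<forall>a\<in>f ` A. \<forall>b\<in>f ` B. mdist Y a b \<le> s \<longrightarrow> a \<in> K \<and> b \<in> K)"
    using nc unfolding close_subsets_iff by blast
  have "\<exists>K. bounded_subset X K \<and> (\<forall>a\<in>A. \<forall>b\<in>B. mdist X a b \<le> r \<longrightarrow> a \<in> K \<and> b \<in> K)" for r
  proof -
    obtain s where s: "\<And>x y. x \<in> mspace X \<Longrightarrow> y \<in> mspace X \<Longrightarrow> mdist X x y \<le> r \<Longrightarrow>
        mdist Y (f x) (f y) \<le> s"
      using coarse_map_controlled[OF f] by blast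
    obtain K where K: "bounded_subset Y K"
        "\<forall>a\<in>f ` A. \<forall>b\<in>f ` B. mdist Y a b \<le> s \<longrightarrow> a \<in> K \<and> b \<in> K"
      using bd by blast
    have "bounded_subset X {x \<in> mspace X. f x \<in> K}"
      using f K(1) by (simp add: coarse_map_iff)
    moreover have "a \<in> {x \<in> mspace X. f x \<in> K} \<and> b \<in> {x \<in> mspace X. f x \<in> K}"
      if "a \<in> A" "b \<in> B" "mdist X a b \<le> r" for a b
      using K(2) s[of a b] that sub by blast
    ultimately show ?thesis by blast
  qed
  then show False
    using AB unfolding close_subsets_iff by blast
qed

lemma coarse_cover_preimage:
  assumes f: "coarse_map X Y f" and V: "coarse_cover Y \<V>"
  shows "coarse_cover X ((\<lambda>V. {x \<in> mspace X. f x \<in> V}) ` \<V>)"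
proof (rule coarse_coverI)
  fix r
  obtain s where s: "\<And>x y. x \<in> mspace X \<Longrightarrow> y \<in> mspace X \<Longrightarrow> mdist X x y \<le> r \<Longrightarrow>
      mdist Y (f x) (f y) \<le> s"
    using coarse_map_controlled[OF f] by blast
  obtain K where K: "bounded_subset Y K" "\<And>x y. x \<in> mspace Y \<Longrightarrow> y \<in> mspace Y \<Longrightarrow>
      mdist Y x y \<le> s \<Longrightarrow> x \<notin> K \<or> y \<notin> K \<Longrightarrow> \<exists>V\<in>\<V>. x \<in> V \<and> y \<in> V"
    using V unfolding coarse_cover_iff by meson
  have "bounded_subset X {x \<in> mspace X. f x \<in> K}"
    using f K(1) by (simp add: coarse_map_iff)
  moreover have "\<exists>U\<in>(\<lambda>V. {x \<in> mspace X. f x \<in> V}) ` \<V>. x \<in> U \<and> y \<in> U"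
    if xy: "x \<in> mspace X" "y \<in> mspace X" "mdist X x y \<le> r" "x \<notin> {x \<in> mspace X. f x \<in> K}" for x y
  proof -
    obtain V where "V \<in> \<V>" "f x \<in> V" "f y \<in> V"
      using K(2)[of "f x" "f y"] s[of x y] xy coarse_map_in_mspace[OF f, of x]
        coarse_map_in_mspace[OF f, of y] by auto
    then show ?thesis using xy(1,2) by auto
  qed
  ultimately show "\<exists>K. bounded_subset X K \<and> (\<forall>x\<in>mspace X. \<forall>y\<in>mspace X.
      mdist X x y \<le> r \<and> x \<notin> K \<and> y \<notin> K \<longrightarrow>
      (\<exists>U\<in>(\<lambda>V. {x \<in> mspace X. f x \<in> V}) ` \<V>. x \<in> U \<and> y \<in> U))"
    by blast
qed (use V in \<open>auto simp: coarse_cover_def\<close>)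

text \<open>Each member \<open>f\<inverse>(V)\<close> of the star has an image close to \<open>f ` A\<close> and contained in \<open>V\<close>, so
  \<open>V\<close> itself occurs in the star of \<open>f ` A\<close>.\<close>

lemma image_coarse_star_preimage:
  assumes f: "coarse_map X Y f" and V: "coarse_cover Y \<V>"
  shows "f ` coarse_star X A ((\<lambda>V. {x \<in> mspace X. f x \<in> V}) ` \<V>) \<subseteq> coarse_star Y (f ` A) \<V>"
proof clarify
  fix x
  assume "x \<in> coarse_star X A ((\<lambda>V. {x \<in> mspace X. f x \<in> V}) ` \<V>)"
  then obtain V where V': "V \<in> \<V>" "close_subsets X A {x \<in> mspace X. f x \<in> V}" "f x \<in> V"
    by (auto simp: coarse_star_def)
  have "close_subsets Y (f ` A) V"
  proof (rule close_subsets_mono[OF close_subsets_image[OF f V'(2)]])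
    show "f ` A \<subseteq> mspace Y"
      using V'(2) coarse_map_in_mspace[OF f] by (auto simp: close_subsets_def)
    show "V \<subseteq> mspace Y"
      using V V'(1) by (simp add: coarse_cover_def)
  qed auto
  then show "f x \<in> coarse_star Y (f ` A) \<V>"
    using V' by (auto simp: coarse_star_def)
qed


section \<open>Endpoints and their uniformity\<close>

lemma hausdorff_distance_finite_iff:
  assumes "A \<subseteq> mspace X" "B \<subseteq> mspace X"
  shows "hausdorff_distance X A B < \<infinity> \<longleftrightarrow> coarsely_within X A B \<and> coarsely_within X B A"
proof -
  have one_sided: "(SUP a\<in>A. INF b\<in>B. ennreal (mdist X a b)) < \<infinity> \<longleftrightarrow> coarsely_within X A B"
    if sub: "A \<subseteq> mspace X" "B \<subseteq> mspace X" for A B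
  proof
    assume fin: "(SUP a\<in>A. INF b\<in>B. ennreal (mdist X a b)) < \<infinity>"
    then obtain r where r: "(SUP a\<in>A. INF b\<in>B. ennreal (mdist X a b)) = ennreal r" "0 \<le> r"
      by (auto simp: less_top_ennreal)
    have "\<exists>b\<in>B. mdist X a b \<le> r + 1" if "a \<in> A" for a
    proof -
      have "(INF b\<in>B. ennreal (mdist X a b)) \<le> ennreal r"
        unfolding r(1)[symmetric] using that by (rule SUP_upper)
      also have "\<dots> < ennreal (r + 1)"
        using r(2) by (simp add: ennreal_less_iff)
      finally obtain b where "b \<in> B" "ennreal (mdist X a b) < ennreal (r + 1)"
        by (auto simp: INF_less_iff)
      then show ?thesis
        by (intro bexI[of _ b]) (auto simp: ennreal_less_iff)
    qed
    then show "coarsely_within X A B"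
      using sub unfolding coarsely_within_def by blast
  next
    assume "coarsely_within X A B"
    then obtain r where r: "\<And>a. a \<in> A \<Longrightarrow> \<exists>b\<in>B. mdist X a b \<le> r"
      unfolding coarsely_within_def by blast
    have "(SUP a\<in>A. INF b\<in>B. ennreal (mdist X a b)) \<le> ennreal r"
    proof (rule SUP_least)
      fix a
      assume "a \<in> A"
      then obtain b where "b \<in> B" "mdist X a b \<le> r"
        using r by blast
      then show "(INF b\<in>B. ennreal (mdist X a b)) \<le> ennreal r"
        by (intro INF_lower2[of b]) (auto intro: ennreal_leI)
    qed
    also have "\<dots> < \<infinity>" by simp
    finally show "(SUP a\<in>A. INF b\<in>B. ennreal (mdist X a b)) < \<infinity>" .
  qed
  have "(SUP b\<in>B. INF a\<in>A. ennreal (mdist X a b)) = (SUP b\<in>B. INF a\<in>A. ennreal (mdist X b a))"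
    by (intro SUP_cong INF_cong refl arg_cong[of _ _ ennreal] mdist_commute)
  then show ?thesis
    using one_sided[OF assms] one_sided[OF assms(2,1)]
    by (simp only: hausdorff_distance_def max_less_iff_conj)
qed

lemma range_coarse_map: "coarse_map Zplus X \<phi> \<Longrightarrow> range \<phi> \<subseteq> mspace X"
  by (auto simp: coarse_map_def)

lemma end_equiv_iff:
  "(\<phi>, \<psi>) \<in> end_equiv X \<longleftrightarrow> coarse_map Zplus X \<phi> \<and> coarse_map Zplus X \<psi> \<and>
     coarsely_within X (range \<phi>) (range \<psi>) \<and> coarsely_within X (range \<psi>) (range \<phi>)"
proof -
  have "hausdorff_distance X (range \<phi>) (range \<psi>) < \<infinity> \<longleftrightarrow>
      coarsely_within X (range \<phi>) (range \<psi>) \<and> coarsely_within X (range \<psi>) (range \<phi>)"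
    if "coarse_map Zplus X \<phi>" "coarse_map Zplus X \<psi>"
    using that by (intro hausdorff_distance_finite_iff range_coarse_map)
  then show ?thesis
    unfolding end_equiv_def by blast
qed

lemma equiv_end_equiv: "equiv {\<phi>. coarse_map Zplus X \<phi>} (end_equiv X)"
proof (rule equivI)
  show "end_equiv X \<subseteq> {\<phi>. coarse_map Zplus X \<phi>} \<times> {\<phi>. coarse_map Zplus X \<phi>}"
    by (auto simp: end_equiv_def)
  show "refl_on {\<phi>. coarse_map Zplus X \<phi>} (end_equiv X)"
    by (rule refl_onI) (simp add: end_equiv_iff coarsely_within_subset range_coarse_map)
  show "sym (end_equiv X)"
    by (rule symI) (simp add: end_equiv_iff)
  show "trans (end_equiv X)"
    by (rule transI) (auto simp: end_equiv_iff intro: coarsely_within_trans)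
qed

lemma endpoint_self: "coarse_map Zplus X \<phi> \<Longrightarrow> \<phi> \<in> endpoint X \<phi>"
  using equiv_class_self[OF equiv_end_equiv] by fastforce

lemma endpoint_in_ends: "coarse_map Zplus X \<phi> \<Longrightarrow> endpoint X \<phi> \<in> ends X"
  by (simp add: ends_def quotientI)

lemma endsE:
  assumes "p \<in> ends X"
  obtains \<phi> where "coarse_map Zplus X \<phi>" "p = endpoint X \<phi>"
  using assms unfolding ends_def by (auto elim: quotientE)

text \<open>Changing the coarse map within its closeness class and changing the representative of the
  endpoint each move the range of the composite by a finite distance only.\<close>

lemma end_equiv_comp:
  assumes fg: "(f, g) \<in> closeness X Y" and eq: "(\<phi>, \<psi>) \<in> end_equiv X"
  shows "(f \<circ> \<phi>, g \<circ> \<psi>) \<in> end_equiv Y"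
proof -
  have co: "coarse_map X Y f" "coarse_map X Y g" "coarse_map Zplus X \<phi>" "coarse_map Zplus X \<psi>"
    using fg eq by (auto simp: closeness_iff end_equiv_iff)
  have gf: "(g, f) \<in> closeness X Y"
    using fg equiv_closeness by (meson equivE symD)
  have "coarsely_within Y (f ` range \<phi>) (g ` range \<psi>)"
    using coarsely_within_trans[OF coarsely_within_image[OF co(1)]
        close_maps_coarsely_within[OF fg range_coarse_map[OF co(4)]]] eq
    by (simp add: end_equiv_iff)
  moreover have "coarsely_within Y (g ` range \<psi>) (f ` range \<phi>)"
    using coarsely_within_trans[OF coarsely_within_image[OF co(2)]
        close_maps_coarsely_within[OF gf range_coarse_map[OF co(3)]]] eq
    by (simp add: end_equiv_iff)
  ultimately show ?thesis
    using coarse_map_comp[OF co(3,1)] coarse_map_comp[OF co(4,2)]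
    by (simp add: end_equiv_iff image_comp)
qed

lemma ends_map_endpoint:
  assumes f: "coarse_map X Y f" and \<phi>: "coarse_map Zplus X \<phi>"
  shows "ends_map X Y (coarse_class X Y f) (endpoint X \<phi>) = endpoint Y (f \<circ> \<phi>)"
proof -
  have "endpoint Y (g \<circ> \<psi>) = endpoint Y (f \<circ> \<phi>)"
    if "g \<in> coarse_class X Y f" "\<psi> \<in> endpoint X \<phi>" for g \<psi>
    using that end_equiv_comp[of f g X Y \<phi> \<psi>]
    by (intro equiv_class_eq[OF equiv_end_equiv, symmetric]) auto
  then have "(\<Union>g\<in>coarse_class X Y f. \<Union>\<psi>\<in>endpoint X \<phi>. endpoint Y (g \<circ> \<psi>)) =
      endpoint Y (f \<circ> \<phi>)"
    using coarse_class_self[OF f] endpoint_self[OF \<phi>] by blast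
  then show ?thesis
    by (simp add: ends_map_def endpoint_in_ends[OF \<phi>])
qed

lemma ends_map_in_ends:
  assumes "coarse_map X Y f"
  shows "ends_map X Y (coarse_class X Y f) \<in> ends X \<rightarrow>\<^sub>E ends Y"
proof (rule PiE_I)
  fix p
  assume "p \<in> ends X"
  then show "ends_map X Y (coarse_class X Y f) p \<in> ends Y"
    using assms by (auto elim!: endsE simp: ends_map_endpoint endpoint_in_ends coarse_map_comp)
qed (simp add: ends_map_def)

lemma ends_map_id: "ends_map X X (coarse_class X X id) = restrict id (ends X)"
proof
  fix p
  show "ends_map X X (coarse_class X X id) p = restrict id (ends X) p"
  proof (cases "p \<in> ends X")
    case True
    then show ?thesis
      by (auto elim!: endsE simp: ends_map_endpoint coarse_map_id endpoint_in_ends)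
  qed (simp add: ends_map_def)
qed

lemma ends_map_comp:
  assumes f: "coarse_map X Y f" and g: "coarse_map Y Z g"
  shows "ends_map X Z (coarse_class X Z (g \<circ> f)) =
    compose (ends X) (ends_map Y Z (coarse_class Y Z g)) (ends_map X Y (coarse_class X Y f))"
proof
  fix p
  show "ends_map X Z (coarse_class X Z (g \<circ> f)) p =
    compose (ends X) (ends_map Y Z (coarse_class Y Z g)) (ends_map X Y (coarse_class X Y f)) p"
  proof (cases "p \<in> ends X")
    case True
    then obtain \<phi> where "coarse_map Zplus X \<phi>" "p = endpoint X \<phi>"
      by (rule endsE)
    then show ?thesis
      using True f g by (simp add: compose_def ends_map_endpoint coarse_map_comp comp_assoc)
  qed (simp add: ends_map_def compose_def)
qed

text \<open>Equivalent maps have ranges within finite distance of each other, and the coarse star only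
  depends on a set up to finite distance; so the representatives chosen existentially in the
  definition may be replaced by any others. The single entourage demanded there is the union of
  the two that the two inclusions provide.\<close>

lemma cover_rel_endpoint_iff:
  assumes \<phi>: "coarse_map Zplus X \<phi>" and \<psi>: "coarse_map Zplus X \<psi>"
  shows "(endpoint X \<phi>, endpoint X \<psi>) \<in> cover_rel X \<U> \<longleftrightarrow>
     coarsely_within X (range \<psi>) (coarse_star X (range \<phi>) \<U>) \<and>
     coarsely_within X (range \<phi>) (coarse_star X (range \<psi>) \<U>)"
    (is "_ \<longleftrightarrow> ?R \<phi> \<psi>")
proof
  assume "(endpoint X \<phi>, endpoint X \<psi>) \<in> cover_rel X \<U>"
  then obtain \<phi>' \<psi>' E where eq: "(\<phi>, \<phi>') \<in> end_equiv X" "(\<psi>, \<psi>') \<in> end_equiv X"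
    and E: "entourage X E" "range \<psi>' \<subseteq> ent_image E (coarse_star X (range \<phi>') \<U>)"
      "range \<phi>' \<subseteq> ent_image E (coarse_star X (range \<psi>') \<U>)"
    by (auto simp: cover_rel_def)
  have "range \<phi>' \<subseteq> mspace X" "range \<psi>' \<subseteq> mspace X"
    using eq by (auto simp: end_equiv_iff dest!: range_coarse_map)
  then have "?R \<phi>' \<psi>'"
    using E ent_image_iff_coarsely_within coarse_star_subset_mspace by metis
  moreover have "coarsely_within X (range b) (coarse_star X (range a) \<U>)"
    if "coarsely_within X (range b') (coarse_star X (range a') \<U>)"
      "(a, a') \<in> end_equiv X" "(b, b') \<in> end_equiv X" for a a' b b'
  proof -
    have "coarse_star X (range a') \<U> \<subseteq> coarse_star X (range a) \<U>"
      using that(2) by (intro coarse_star_coarsely_within) (simp add: end_equiv_iff)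
    then have "coarsely_within X (coarse_star X (range a') \<U>) (coarse_star X (range a) \<U>)"
      using coarse_star_subset_mspace by (rule coarsely_within_subset)
    then show ?thesis
      using that(1,3) coarsely_within_trans unfolding end_equiv_iff by blast
  qed
  ultimately show "?R \<phi> \<psi>"
    using eq by blast
next
  assume R: "?R \<phi> \<psi>"
  note sub = range_coarse_map[OF \<phi>] range_coarse_map[OF \<psi>]
  obtain E where E: "entourage X E" "range \<psi> \<subseteq> ent_image E (coarse_star X (range \<phi>) \<U>)"
    using R ent_image_iff_coarsely_within[OF sub(2) coarse_star_subset_mspace] by blast
  obtain F where F: "entourage X F" "range \<phi> \<subseteq> ent_image F (coarse_star X (range \<psi>) \<U>)"
    using R ent_image_iff_coarsely_within[OF sub(1) coarse_star_subset_mspace] by blast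
  have "entourage X (E \<union> F)"
    using E(1) F(1) by (auto simp: entourage_def image_Un)
  moreover have "ent_image E A \<subseteq> ent_image (E \<union> F) A" "ent_image F A \<subseteq> ent_image (E \<union> F) A" for A
    by (auto simp: ent_image_def)
  ultimately show "(endpoint X \<phi>, endpoint X \<psi>) \<in> cover_rel X \<U>"
    using E(2) F(2) endpoint_self[OF \<phi>] endpoint_self[OF \<psi>] endpoint_in_ends[OF \<phi>]
      endpoint_in_ends[OF \<psi>]
    unfolding cover_rel_def by blast
qed

lemma cover_relE:
  assumes "(p, q) \<in> cover_rel X \<U>"
  obtains \<phi> \<psi> where "coarse_map Zplus X \<phi>" "p = endpoint X \<phi>"
    "coarse_map Zplus X \<psi>" "q = endpoint X \<psi>"
    "coarsely_within X (range \<psi>) (coarse_star X (range \<phi>) \<U>)"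
    "coarsely_within X (range \<phi>) (coarse_star X (range \<psi>) \<U>)"
proof -
  have "p \<in> ends X" "q \<in> ends X"
    using assms by (auto simp: cover_rel_def)
  then obtain \<phi> \<psi> where "coarse_map Zplus X \<phi>" "p = endpoint X \<phi>"
      "coarse_map Zplus X \<psi>" "q = endpoint X \<psi>"
    by (auto elim!: endsE)
  then show ?thesis
    using assms that cover_rel_endpoint_iff by blast
qed

text \<open>A coarse map on \<open>\<nat>\<close> has unbounded range, since the preimage of a bounded set is bounded, that
  is, finite.\<close>

lemma cover_rel_refl:
  assumes U: "coarse_cover X \<U>" and p: "p \<in> ends X"
  shows "(p, p) \<in> cover_rel X \<U>"
proof -
  obtain \<phi> where \<phi>: "coarse_map Zplus X \<phi>" "p = endpoint X \<phi>"
    using p by (rule endsE)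
  have "\<not> bounded_subset X (range \<phi>)"
  proof
    assume "bounded_subset X (range \<phi>)"
    then have "bounded_subset Zplus (UNIV :: nat set)"
      using \<phi>(1) unfolding coarse_map_iff by fastforce
    then obtain r where "\<And>n :: nat. real n \<le> r"
      using bounded_subset_iff_center[of 0 Zplus UNIV] by auto
    moreover obtain n :: nat where "r < real n"
      using reals_Archimedean2 by blast
    ultimately show False
      by (meson not_le)
  qed
  then have "coarsely_within X (range \<phi>) (coarse_star X (range \<phi>) \<U>)"
    using U range_coarse_map[OF \<phi>(1)] by (intro coarsely_within_coarse_star_self)
  then show ?thesis
    using \<phi> cover_rel_endpoint_iff[OF \<phi>(1) \<phi>(1)] by simp
qed

lemma cover_rel_sym: "(p, q) \<in> cover_rel X \<U> \<Longrightarrow> (q, p) \<in> cover_rel X \<U>"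
  by (elim cover_relE) (simp add: cover_rel_endpoint_iff)

lemma cover_rel_refinement:
  assumes "\<And>W. W \<in> \<W> \<Longrightarrow> \<exists>U\<in>\<U>. W \<subseteq> U" "coarse_cover X \<U>"
  shows "cover_rel X \<W> \<subseteq> cover_rel X \<U>"
proof clarify
  fix p q
  assume "(p, q) \<in> cover_rel X \<W>"
  moreover have "coarsely_within X (coarse_star X A \<W>) (coarse_star X A \<U>)" for A
    using assms by (intro coarsely_within_subset coarse_star_refinement coarse_star_subset_mspace)
      (auto simp: coarse_cover_def)
  ultimately show "(p, q) \<in> cover_rel X \<U>"
    by (elim cover_relE) (auto simp: cover_rel_endpoint_iff intro: coarsely_within_trans)
qed

lemma cover_rel_comp_refinement:
  assumes U: "coarse_cover X \<U>"
  obtains \<W> where "coarse_cover X \<W>" "cover_rel X \<W> O cover_rel X \<W> \<subseteq> cover_rel X \<U>"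
proof -
  obtain \<W> where W: "coarse_cover X \<W>"
      "\<And>V W. V \<in> \<W> \<Longrightarrow> W \<in> \<W> \<Longrightarrow> close_subsets X V W \<Longrightarrow> V \<times> W \<subseteq> (\<Union>U\<in>\<U>. U \<times> U)"
    by (rule coarse_cover_star_refinement[OF U]) (rule that)
  have chain: "coarsely_within X C (coarse_star X A \<U>)"
    if "coarsely_within X B (coarse_star X A \<W>)" "coarsely_within X C (coarse_star X B \<W>)"
    for A B C
    using coarsely_within_trans[OF that(2) coarsely_within_subset[OF
          coarse_star_star_refinement[OF U W that(1)] coarse_star_subset_mspace]] .
  have "(p, r) \<in> cover_rel X \<U>" if pq: "(p, q) \<in> cover_rel X \<W>" and qr: "(q, r) \<in> cover_rel X \<W>"
    for p q r
  proof -
    have "p \<in> ends X" "q \<in> ends X" "r \<in> ends X"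
      using pq qr by (auto simp: cover_rel_def)
    then obtain \<phi> \<psi> \<theta> where rep: "coarse_map Zplus X \<phi>" "p = endpoint X \<phi>"
        "coarse_map Zplus X \<psi>" "q = endpoint X \<psi>" "coarse_map Zplus X \<theta>" "r = endpoint X \<theta>"
      by (elim endsE)
    then show ?thesis
      using pq qr chain[of "range \<psi>" "range \<phi>" "range \<theta>"] chain[of "range \<psi>" "range \<theta>" "range \<phi>"]
      by (simp add: cover_rel_endpoint_iff)
  qed
  then show ?thesis
    using that[OF W(1)] by blast
qed

lemma cover_rel_common_refinement:
  assumes "coarse_cover X \<U>" "coarse_cover X \<V>"
  obtains \<W> where "coarse_cover X \<W>" "cover_rel X \<W> \<subseteq> cover_rel X \<U> \<inter> cover_rel X \<V>"
proof -
  obtain \<W> where W: "coarse_cover X \<W>"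
      "\<And>W. W \<in> \<W> \<Longrightarrow> \<exists>U\<in>\<U>. W \<subseteq> U" "\<And>W. W \<in> \<W> \<Longrightarrow> \<exists>V\<in>\<V>. W \<subseteq> V"
    by (rule coarse_cover_common_refinement[OF assms]) (rule that)
  then show ?thesis
    using that cover_rel_refinement[of \<W> \<U> X] cover_rel_refinement[of \<W> \<V> X] assms by simp
qed

lemma cover_rel_subset: "cover_rel X \<U> \<subseteq> ends X \<times> ends X"
  by (auto simp: cover_rel_def)

lemma cover_rel_in_ends_uniform:
  "coarse_cover X \<U> \<Longrightarrow> cover_rel X \<U> \<in> snd (ends_uniform X)"
  using cover_rel_subset by (auto simp: ends_uniform_def)

lemma uniform_structure_ends:
  "uniform_structure (fst (ends_uniform X)) (snd (ends_uniform X))"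
  unfolding uniform_structure_def
proof (intro conjI ballI allI impI)
  show "snd (ends_uniform X) \<noteq> {}"
    using cover_rel_in_ends_uniform[OF coarse_cover_whole_space] by blast
  fix V
  assume "V \<in> snd (ends_uniform X)"
  then obtain \<U> where V: "V \<subseteq> ends X \<times> ends X" and U: "coarse_cover X \<U>" "cover_rel X \<U> \<subseteq> V"
    by (auto simp: ends_uniform_def)
  show "Id_on (fst (ends_uniform X)) \<subseteq> V"
    using cover_rel_refl[OF U(1)] U(2) by (auto simp: ends_uniform_def)
  show "V \<subseteq> fst (ends_uniform X) \<times> fst (ends_uniform X)"
    using V by (simp add: ends_uniform_def)
  show "W \<in> snd (ends_uniform X)"
    if "V \<subseteq> W \<and> W \<subseteq> fst (ends_uniform X) \<times> fst (ends_uniform X)" for W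
    using that U by (auto simp: ends_uniform_def)
  show "V \<inter> W \<in> snd (ends_uniform X)" if W: "W \<in> snd (ends_uniform X)" for W
  proof -
    obtain \<V> where V': "coarse_cover X \<V>" "cover_rel X \<V> \<subseteq> W"
      using W by (auto simp: ends_uniform_def)
    obtain \<W> where "coarse_cover X \<W>" "cover_rel X \<W> \<subseteq> cover_rel X \<U> \<inter> cover_rel X \<V>"
      using cover_rel_common_refinement[OF U(1) V'(1)] .
    then show ?thesis
      using V U(2) V'(2) by (auto simp: ends_uniform_def intro!: exI[of _ \<W>])
  qed
  have "cover_rel X \<U> \<subseteq> V\<inverse>"
    using U(2) by (auto dest: cover_rel_sym)
  then show "V\<inverse> \<in> snd (ends_uniform X)"
    using V U(1) by (auto simp: ends_uniform_def)
  obtain \<W> where "coarse_cover X \<W>" "cover_rel X \<W> O cover_rel X \<W> \<subseteq> cover_rel X \<U>"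
    using cover_rel_comp_refinement[OF U(1)] .
  then show "\<exists>W\<in>snd (ends_uniform X). W O W \<subseteq> V"
    using U(2) cover_rel_in_ends_uniform by (intro bexI[of _ "cover_rel X \<W>"]) (rule order_trans)
qed

lemma ends_map_uniform:
  assumes f: "coarse_map X Y f"
  shows "uniform_map (ends_uniform X) (ends_uniform Y) (ends_map X Y (coarse_class X Y f))"
    (is "uniform_map _ _ ?F")
  unfolding uniform_map_def
proof (intro conjI ballI)
  show "?F \<in> fst (ends_uniform X) \<rightarrow> fst (ends_uniform Y)"
    using ends_map_in_ends[OF f] by (auto simp: ends_uniform_def)
  fix V
  assume "V \<in> snd (ends_uniform Y)"
  then obtain \<V> where V: "coarse_cover Y \<V>" "cover_rel Y \<V> \<subseteq> V"
    by (auto simp: ends_uniform_def)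
  let ?U = "(\<lambda>V. {x \<in> mspace X. f x \<in> V}) ` \<V>"
  have image: "coarsely_within Y (range (f \<circ> \<psi>)) (coarse_star Y (range (f \<circ> \<phi>)) \<V>)"
    if "coarsely_within X (range \<psi>) (coarse_star X (range \<phi>) ?U)" for \<phi> \<psi> :: "nat \<Rightarrow> 'a"
    using coarsely_within_trans[OF coarsely_within_image[OF f that] coarsely_within_subset[OF
          image_coarse_star_preimage[OF f V(1)] coarse_star_subset_mspace]]
    by (simp add: image_comp)
  have "(?F p, ?F q) \<in> cover_rel Y \<V>" if "(p, q) \<in> cover_rel X ?U" for p q
    using that
    by (elim cover_relE)
      (simp only: ends_map_endpoint[OF f] cover_rel_endpoint_iff coarse_map_comp[OF _ f] image simp_thms)
  then have "cover_rel X ?U \<subseteq> {(p, q) \<in> ends X \<times> ends X. (?F p, ?F q) \<in> V}"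
    using V(2) cover_rel_subset[of X ?U] by blast
  then show "{(p, q) \<in> fst (ends_uniform X) \<times> fst (ends_uniform X). (?F p, ?F q) \<in> V}
      \<in> snd (ends_uniform X)"
    using coarse_cover_preimage[OF f V(1)] unfolding ends_uniform_def by auto
qed


section \<open>The induced topology\<close>

lemma istopology_ends_open: "istopology (ends_open X)"
  unfolding istopology_def
proof (intro conjI allI impI)
  fix S T
  assume S: "ends_open X S" and T: "ends_open X T"
  show "ends_open X (S \<inter> T)"
    unfolding ends_open_def
  proof (intro conjI ballI)
    show "S \<inter> T \<subseteq> ends X"
      using S by (auto simp: ends_open_def)
    fix p
    assume p: "p \<in> S \<inter> T"
    obtain \<U> where U: "coarse_cover X \<U>" "cover_rel X \<U> `` {p} \<subseteq> S"
      using S p unfolding ends_open_def by blast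
    obtain \<V> where V: "coarse_cover X \<V>" "cover_rel X \<V> `` {p} \<subseteq> T"
      using T p unfolding ends_open_def by blast
    obtain \<W> where "coarse_cover X \<W>" "cover_rel X \<W> \<subseteq> cover_rel X \<U> \<inter> cover_rel X \<V>"
      using cover_rel_common_refinement[OF U(1) V(1)] .
    then show "\<exists>\<W>. coarse_cover X \<W> \<and> cover_rel X \<W> `` {p} \<subseteq> S \<inter> T"
      using U(2) V(2) by blast
  qed
next
  fix \<K>
  assume K: "\<forall>S\<in>\<K>. ends_open X S"
  show "ends_open X (\<Union>\<K>)"
    unfolding ends_open_def
  proof (intro conjI ballI)
    show "\<Union>\<K> \<subseteq> ends X"
      using K by (auto simp: ends_open_def)
    fix p
    assume "p \<in> \<Union>\<K>"
    then obtain S where S: "S \<in> \<K>" "p \<in> S" by blast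
    then obtain \<U> where "coarse_cover X \<U>" "cover_rel X \<U> `` {p} \<subseteq> S"
      using K unfolding ends_open_def by blast
    then show "\<exists>\<U>. coarse_cover X \<U> \<and> cover_rel X \<U> `` {p} \<subseteq> \<Union>\<K>"
      using S(1) by blast
  qed
qed

lemma openin_ends_topology: "openin (ends_topology X) = ends_open X"
  by (simp add: ends_topology_def topology_inverse' istopology_ends_open)

lemma topspace_ends_topology [simp]: "topspace (ends_topology X) = ends X"
proof
  show "topspace (ends_topology X) \<subseteq> ends X"
    using openin_topspace[of "ends_topology X"] unfolding openin_ends_topology ends_open_def
    by blast
  have "ends_open X (ends X)"
    using coarse_cover_whole_space cover_rel_subset unfolding ends_open_def by blast
  then show "ends X \<subseteq> topspace (ends_topology X)"
    by (simp add: openin_subset openin_ends_topology)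
qed

lemma uniform_map_continuous:
  assumes F: "uniform_map (ends_uniform X) (ends_uniform Y) F"
  shows "continuous_map (ends_topology X) (ends_topology Y) F"
  unfolding continuous_map_def topspace_ends_topology openin_ends_topology
proof (intro conjI allI impI)
  show "F \<in> ends X \<rightarrow> ends Y"
    using F by (auto simp: uniform_map_def ends_uniform_def)
  fix W
  assume W: "ends_open Y W"
  show "ends_open X {p \<in> ends X. F p \<in> W}"
    unfolding ends_open_def
  proof (intro conjI ballI)
    fix p
    assume p: "p \<in> {p \<in> ends X. F p \<in> W}"
    then obtain \<V> where V: "coarse_cover Y \<V>" "cover_rel Y \<V> `` {F p} \<subseteq> W"
      using W unfolding ends_open_def by blast
    have "{(p, q) \<in> ends X \<times> ends X. (F p, F q) \<in> cover_rel Y \<V>} \<in> snd (ends_uniform X)"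
      using F cover_rel_in_ends_uniform[OF V(1)] by (simp add: uniform_map_def ends_uniform_def)
    then obtain \<U> where U: "coarse_cover X \<U>"
        "cover_rel X \<U> \<subseteq> {(p, q) \<in> ends X \<times> ends X. (F p, F q) \<in> cover_rel Y \<V>}"
      by (auto simp: ends_uniform_def)
    then have "cover_rel X \<U> `` {p} \<subseteq> {p \<in> ends X. F p \<in> W}"
      using V(2) by blast
    then show "\<exists>\<U>. coarse_cover X \<U> \<and> cover_rel X \<U> `` {p} \<subseteq> {p \<in> ends X. F p \<in> W}"
      using U(1) by blast
  qed blast
qed


section \<open>Functoriality\<close>

lemma compose_restrict_id_left: "f \<in> A \<rightarrow>\<^sub>E B \<Longrightarrow> compose A (restrict id B) f = f"
  by (auto simp: compose_def fun_eq_iff PiE_iff extensional_def)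

lemma compose_restrict_id_right: "f \<in> A \<rightarrow>\<^sub>E B \<Longrightarrow> compose A f (restrict id A) = f"
  by (auto simp: compose_def fun_eq_iff PiE_iff extensional_def)

lemma compose_PiE: "f \<in> A \<rightarrow>\<^sub>E B \<Longrightarrow> g \<in> B \<rightarrow>\<^sub>E C \<Longrightarrow> compose A g f \<in> A \<rightarrow>\<^sub>E C"
  by (auto simp: compose_def)

lemma is_category_Top: "is_category Top"
proof (unfold_locales, goal_cases)
  case (1 S)
  have "continuous_map S S (restrict id (topspace S))"
    by (rule continuous_map_eq[OF continuous_map_id]) simp
  then show ?case by (simp add: Top_def)
next
  case (2 S T U f g)
  then have "continuous_map S U (g \<circ> f)"
    by (auto simp: Top_def intro: continuous_map_compose)
  then have "continuous_map S U (compose (topspace S) g f)"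
    by (rule continuous_map_eq) (simp add: compose_def)
  then show ?case
    using 2 by (simp add: Top_def compose_PiE[of f "topspace S" "topspace T" g "topspace U"])
next
  case (3 S T f)
  then show ?case by (simp add: Top_def compose_restrict_id_left)
next
  case (4 S T f)
  then show ?case by (simp add: Top_def compose_restrict_id_right[of f "topspace S" "topspace T"])
next
  case (5 R S T U f g h)
  then show ?case
    by (simp add: Top_def compose_assoc[of f "topspace R" "topspace S"] PiE_iff Pi_iff)
qed

lemma uniform_map_restrict_id:
  assumes "uniform_structure (fst S) (snd S)"
  shows "uniform_map S S (restrict id (fst S))"
proof -
  have "{(p, q) \<in> fst S \<times> fst S. (restrict id (fst S) p, restrict id (fst S) q) \<in> V} = V"
    if "V \<in> snd S" for V
    using assms that unfolding uniform_structure_def by fastforce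
  then show ?thesis
    by (auto simp: uniform_map_def)
qed

lemma uniform_map_compose:
  assumes f: "uniform_map S T f" and g: "uniform_map T U g"
  shows "uniform_map S U (compose (fst S) g f)"
  unfolding uniform_map_def
proof (intro conjI ballI)
  show "compose (fst S) g f \<in> fst S \<rightarrow> fst U"
    using f g by (auto simp: uniform_map_def compose_def)
  fix V
  assume "V \<in> snd U"
  then have "{(p, q) \<in> fst T \<times> fst T. (g p, g q) \<in> V} \<in> snd T"
    using g by (simp add: uniform_map_def)
  then have "{(p, q) \<in> fst S \<times> fst S. (f p, f q) \<in> {(p, q) \<in> fst T \<times> fst T. (g p, g q) \<in> V}}
      \<in> snd S"
    using f unfolding uniform_map_def by blast
  moreover have "{(p, q) \<in> fst S \<times> fst S. (compose (fst S) g f p, compose (fst S) g f q) \<in> V} =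
      {(p, q) \<in> fst S \<times> fst S. (f p, f q) \<in> {(p, q) \<in> fst T \<times> fst T. (g p, g q) \<in> V}}"
    using f by (auto simp: compose_def uniform_map_def)
  ultimately show "{(p, q) \<in> fst S \<times> fst S.
      (compose (fst S) g f p, compose (fst S) g f q) \<in> V} \<in> snd S"
    by simp
qed

lemma is_category_Unif: "is_category Unif"
proof (unfold_locales, goal_cases)
  case (1 S)
  then show ?case by (simp add: Unif_def uniform_map_restrict_id)
next
  case (2 S T U f g)
  then show ?case
    by (simp add: Unif_def compose_PiE[of f "fst S" "fst T" g "fst U"] uniform_map_compose[of S T f U g])
next
  case (3 S T f)
  then show ?case by (simp add: Unif_def compose_restrict_id_left)
next
  case (4 S T f)
  then show ?case by (simp add: Unif_def compose_restrict_id_right[of f "fst S" "fst T"])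
next
  case (5 R S T U f g h)
  then show ?case
    by (simp add: Unif_def compose_assoc[of f "fst R" "fst S"] PiE_iff Pi_iff)
qed

lemma is_functor_ends_Top:
  "is_functor (mCoarse :: ('a metric, ('a \<Rightarrow> 'a) set) cat) Top ends_topology ends_map"
proof (rule is_functor.intro[OF is_category_mCoarse is_category_Top], unfold_locales, goal_cases)
  case (1 X)
  then show ?case by (simp add: Top_def)
next
  case (2 X Y F)
  then obtain f where "coarse_map X Y f" "F = coarse_class X Y f"
    by (auto elim: mCoarse_homE)
  then show ?case
    by (simp add: Top_def ends_map_in_ends uniform_map_continuous ends_map_uniform)
next
  case (3 X)
  then show ?case by (simp add: Top_def ends_map_id)
next
  case (4 X Y Z F G)
  then obtain f g where "coarse_map X Y f" "F = coarse_class X Y f"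
      "coarse_map Y Z g" "G = coarse_class Y Z g"
    by (auto elim!: mCoarse_homE)
  then show ?case
    by (simp add: Top_def mCoarse_comp_class ends_map_comp)
qed

lemma is_functor_ends_Unif:
  "is_functor (mCoarse :: ('a metric, ('a \<Rightarrow> 'a) set) cat) Unif ends_uniform ends_map"
proof (rule is_functor.intro[OF is_category_mCoarse is_category_Unif], unfold_locales, goal_cases)
  case (1 X)
  then show ?case by (simp add: Unif_def uniform_structure_ends)
next
  case (2 X Y F)
  then obtain f where "coarse_map X Y f" "F = coarse_class X Y f"
    by (auto elim: mCoarse_homE)
  moreover have "fst (ends_uniform X) = ends X" for X :: "'a metric"
    by (simp add: ends_uniform_def)
  ultimately show ?case
    by (simp add: Unif_def ends_map_in_ends ends_map_uniform)
next
  case (3 X)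
  then show ?case by (simp add: Unif_def ends_map_id ends_uniform_def)
next
  case (4 X Y Z F G)
  then obtain f g where "coarse_map X Y f" "F = coarse_class X Y f"
      "coarse_map Y Z g" "G = coarse_class Y Z g"
    by (auto elim!: mCoarse_homE)
  then show ?case
    by (simp add: Unif_def mCoarse_comp_class ends_map_comp ends_uniform_def)
qed

theorem theoremA:
  shows "(\<forall>X :: 'a metric. istopology (ends_open X)) \<and>
    (\<forall>(X :: 'a metric) (Y :: 'a metric) f \<phi>.
       coarse_map X Y f \<and> coarse_map Zplus X \<phi> \<longrightarrow>
       ends_map X Y (coarse_class X Y f) (endpoint X \<phi>) = endpoint Y (f \<circ> \<phi>)) \<and>
    is_functor (mCoarse :: ('a metric, ('a \<Rightarrow> 'a) set) cat) Top ends_topology ends_map \<and>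
    is_functor (mCoarse :: ('a metric, ('a \<Rightarrow> 'a) set) cat) Unif ends_uniform ends_map"
  using istopology_ends_open ends_map_endpoint is_functor_ends_Top is_functor_ends_Unif by blast

end
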